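(* Let $S_{p,\gamma,\zeta}(s)$ be a self-similar hierarchical branching process with $0<p<1$, $\gamma>0$ and Tokunaga coefficients $\{T_k\}_{k\ge1}$. Suppose that $L:=\limsup_{k\to\infty}T_k^{1/k}<\infty$ and $\zeta\ge\max(1,L)$. Then the width function $C_{p,\gamma,\zeta}(s)$, $s\ge0$, satisfies $$C_{p,\gamma,\zeta}(s)\ \begin{cases}\text{decreases} & \text{if } p>1-\dfrac{\zeta}{R},\\[1ex] =1 & \text{if } p=1-\dfrac{\zeta}{R},\\[1ex] \text{increases} & \text{if } p<1-\dfrac{\zeta}{R}.\end{cases}$$
   Context: Hierarchical branching process. Given a sequence $\{T_k\}_{k\ge1}$ of nonnegative numbers (Tokunaga coefficients), a sequence $\{\lambda_j\}_{j\ge1}$ of positive numbers and a probability mass function $\{p_K\}_{K\ge1}$, $S=(\{T_k\},\{\lambda_j\},\{p_K\})$ is the multi-type continuous-time branching process that starts with a single root branch of order $K$ with probability $p_K$. Independently of the other branches, every branch of order $j$ produces offspring branches of each order $i<j$ with rate $\lambda_jT_{j-i}$, and terminates with rate $\lambda_j$. After termination, a branch of order $j\ge2$ splits into two branches of order $j-1$; a branch of order 1 terminates without leaving offspring. The self-similar process $S_{p,\gamma,\zeta}$ is the one with $p_K=p(1-p)^{K-1}$, $K\ge1$, and $\lambda_j=\gamma\zeta^{-j}$, $j\ge1$. Width function. Let $x_j(s)=\mathsf{E}(N_j(s))$, where $N_j(s)$ is the number of branches of order $j$ in $S$ at instant $s$. The vector $x(s)=(x_1(s),x_2(s),\dots)$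 is the hydrodynamic limit of the process, i.e. $\dot x=\mathbb{G}\Lambda x$, $x(0)=\pi:=\sum_Kp_Ke_K$, where $\Lambda=\mathrm{diag}\{\lambda_1,\lambda_2,\dots\}$ and $\mathbb{G}$ is the upper triangular Toeplitz operator with $\mathbb{G}_{i,i}=-1$, $\mathbb{G}_{i,i+1}=T_1+2$, $\mathbb{G}_{i,i+k}=T_k$ for $k\ge2$, $\mathbb{G}_{i,j}=0$ for $j<i$. The width function is the average number of branches of any order alive at instant $s$: $$C(s)=\sum_{j\ge1}x_j(s)=\big\|e^{\mathbb{G}\Lambda s}\pi\big\|_1 ,$$ denoted $C_{p,\gamma,\zeta}(s)$ for $S_{p,\gamma,\zeta}$. Horton exponent. Let $\hat t(z)=-1+2z+\sum_{j\ge1}z^jT_j$ for $|z|<1/L$. $w_0$ denotes the unique real root of $\hat t$ within $(0,\tfrac12]$, and $R:=w_0^{-1}$.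
   Formalization: The formal theorem assumes that t̂ has a root w_0 in (0,1/2] with w_0 < 1/L, so that R is defined; this is automatic for L<2 but can fail for larger L, e.g. T_k = ε3^k/k² with ε small. "Decreases" and "increases" are proved strictly. *)

theory Defs
  imports "HOL-Probability.Probability"
begin

section \<open>Genealogy\<close>

text \<open>
  Every branch that can possibly occur carries a genealogical label. \<open>Root k\<close> is a root branch of
  order \<open>k\<close>; \<open>Side b i n\<close> is the \<open>n\<close>-th (counted from 0) offspring of order \<open>i\<close> that \<open>b\<close> produces
  during its lifetime; \<open>Split b False\<close> and \<open>Split b True\<close> are the two branches into which \<open>b\<close>
  splits when it terminates. The order of a branch can be read off its label.
\<close>

datatype branch = Root nat | Side branch nat nat | Split branch bool

fun branch_order :: "branch \<Rightarrow> nat" where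
  "branch_order (Root k) = k"
| "branch_order (Side b i n) = i"
| "branch_order (Split b c) = branch_order b - 1"

text \<open>
  Offspring orders with Tokunaga coefficient 0 are produced at rate 0, that is, never; their labels
  are excluded, so that every clock below has a positive rate.
\<close>

fun possible :: "(nat \<Rightarrow> real) \<Rightarrow> branch \<Rightarrow> bool" where
  "possible T (Root k) \<longleftrightarrow> 1 \<le> k"
| "possible T (Side b i n) \<longleftrightarrow>
     possible T b \<and> 1 \<le> i \<and> i < branch_order b \<and> 0 < T (branch_order b - i)"
| "possible T (Split b c) \<longleftrightarrow> possible T b \<and> 2 \<le> branch_order b"

section \<open>Exponential clocks\<close>

text \<open>
  \<open>Life b\<close> is the lifetime of \<open>b\<close>. \<open>Gap b i n\<close> is the waiting time between the offspring \<open>n - 1\<close>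
  and \<open>n\<close> of order \<open>i\<close> of \<open>b\<close> (for \<open>n = 0\<close>: between the birth of \<open>b\<close> and its first offspring of
  order \<open>i\<close>), so that the partial sums of the gaps form a Poisson process.
\<close>

datatype clock = Life branch | Gap branch nat nat

definition clocks :: "(nat \<Rightarrow> real) \<Rightarrow> clock set" where
  "clocks T = {Life b | b. possible T b} \<union> {Gap b i n | b i n. possible T (Side b i n)}"

fun clock_rate :: "(nat \<Rightarrow> real) \<Rightarrow> (nat \<Rightarrow> real) \<Rightarrow> clock \<Rightarrow> real" where
  "clock_rate T lam (Life b) = lam (branch_order b)"
| "clock_rate T lam (Gap b i n) = lam (branch_order b) * T (branch_order b - i)"

section \<open>The trajectory determined by the root order and the clock values\<close>

fun birth_time :: "(clock \<Rightarrow> real) \<Rightarrow> branch \<Rightarrow> real" where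
  "birth_time x (Root k) = 0"
| "birth_time x (Side b i n) = birth_time x b + (\<Sum>m\<le>n. x (Gap b i m))"
| "birth_time x (Split b c) = birth_time x b + x (Life b)"

text \<open>
  A potential offspring of \<open>b\<close> really occurs iff \<open>b\<close> does and its birth precedes the termination
  of \<open>b\<close>.
\<close>

fun occurs :: "(nat \<Rightarrow> real) \<Rightarrow> nat \<Rightarrow> (clock \<Rightarrow> real) \<Rightarrow> branch \<Rightarrow> bool" where
  "occurs T K x (Root k) \<longleftrightarrow> possible T (Root k) \<and> k = K"
| "occurs T K x (Side b i n) \<longleftrightarrow>
     possible T (Side b i n) \<and> occurs T K x b \<and> (\<Sum>m\<le>n. x (Gap b i m)) < x (Life b)"
| "occurs T K x (Split b c) \<longleftrightarrow> possible T (Split b c) \<and> occurs T K x b"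

definition alive_at :: "(nat \<Rightarrow> real) \<Rightarrow> nat \<Rightarrow> (clock \<Rightarrow> real) \<Rightarrow> real \<Rightarrow> branch \<Rightarrow> bool" where
  "alive_at T K x s b \<longleftrightarrow>
     occurs T K x b \<and> birth_time x b \<le> s \<and> s < birth_time x b + x (Life b)"

text \<open>
  The counting measure gives \<open>\<infinity>\<close> (rather than 0, as \<open>card\<close> would) if there are infinitely many
  branches.
\<close>

definition branch_count ::
    "(nat \<Rightarrow> real) \<Rightarrow> nat \<Rightarrow> (clock \<Rightarrow> real) \<Rightarrow> nat \<Rightarrow> real \<Rightarrow> ennreal" where
  "branch_count T K x j s =
     emeasure (count_space UNIV) {b. branch_order b = j \<and> alive_at T K x s b}"

section \<open>Hierarchical branching processes\<close>

text \<open>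
  Sequences are indexed by \<open>k \<ge> 1\<close>; the values at index 0 are irrelevant. \<open>K\<close> is the random order
  of the root branch and \<open>X c\<close> is the random value of the clock \<open>c\<close>. The last assumption is the joint independence of \<open>K\<close>
  (index \<open>None\<close>, read as a real random variable) and of all clocks.
\<close>

locale hierarchical_branching_process = prob_space M
  for M :: "'w measure"
    and T :: "nat \<Rightarrow> real" and lam :: "nat \<Rightarrow> real" and pr :: "nat \<Rightarrow> real"
    and K :: "'w \<Rightarrow> nat" and X :: "clock \<Rightarrow> 'w \<Rightarrow> real" +
  assumes T_nonneg: "k \<ge> 1 \<Longrightarrow> T k \<ge> 0"
    and lam_pos: "j \<ge> 1 \<Longrightarrow> lam j > 0"
    and pr_nonneg: "k \<ge> 1 \<Longrightarrow> pr k \<ge> 0"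
    and pr_sums: "(\<lambda>k. pr (Suc k)) sums 1"
    and K_measurable: "K \<in> measurable M (count_space UNIV)"
    and root_order: "k \<ge> 1 \<Longrightarrow> prob {\<omega> \<in> space M. K \<omega> = k} = pr k"
    and clock_exponential:
      "c \<in> clocks T \<Longrightarrow> distributed M lborel (X c) (exponential_density (clock_rate T lam c))"
    and all_independent:
      "indep_vars (\<lambda>_. borel)
         (\<lambda>v. case v of None \<Rightarrow> (\<lambda>\<omega>. real (K \<omega>)) | Some c \<Rightarrow> X c)
         (insert None (Some ` clocks T))"

definition mean_count ::
    "'w measure \<Rightarrow> (nat \<Rightarrow> real) \<Rightarrow> ('w \<Rightarrow> nat) \<Rightarrow> (clock \<Rightarrow> 'w \<Rightarrow> real) \<Rightarrow> nat \<Rightarrow> real \<Rightarrow> ennreal"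
  where
  "mean_count M T K X j s = (\<integral>\<^sup>+\<omega>. branch_count T (K \<omega>) (\<lambda>c. X c \<omega>) j s \<partial>M)"

definition width_function ::
    "'w measure \<Rightarrow> (nat \<Rightarrow> real) \<Rightarrow> ('w \<Rightarrow> nat) \<Rightarrow> (clock \<Rightarrow> 'w \<Rightarrow> real) \<Rightarrow> real \<Rightarrow> ennreal"
  where
  "width_function M T K X s = (\<Sum>j. mean_count M T K X (Suc j) s)"

definition self_similar_hbp ::
    "real \<Rightarrow> real \<Rightarrow> real \<Rightarrow> (nat \<Rightarrow> real) \<Rightarrow> 'w measure \<Rightarrow> ('w \<Rightarrow> nat) \<Rightarrow> (clock \<Rightarrow> 'w \<Rightarrow> real) \<Rightarrow> bool"
  where
  "self_similar_hbp p \<gamma> \<zeta> T M K X \<longleftrightarrow>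
     hierarchical_branching_process M T
       (\<lambda>j. \<gamma> * \<zeta> powi (- int j)) (\<lambda>k. p * (1 - p) ^ (k - 1)) K X"

section \<open>Horton exponent\<close>

definition tokunaga_limsup :: "(nat \<Rightarrow> real) \<Rightarrow> ereal" where
  "tokunaga_limsup T = limsup (\<lambda>k. ereal (root k (T k)))"

definition t_hat :: "(nat \<Rightarrow> real) \<Rightarrow> real \<Rightarrow> real" where
  "t_hat T z = - 1 + 2 * z + (\<Sum>j. z ^ Suc j * T (Suc j))"

text \<open>
  \<open>t_hat T\<close> is only meaningful for \<open>\<bar>z\<bar> < 1 / L\<close>, where \<open>L = tokunaga_limsup T\<close>; the quotient is
  taken in the extended reals, so that \<open>1 / L = \<infinity>\<close> if \<open>L = 0\<close>.
\<close>

definition is_horton_root :: "(nat \<Rightarrow> real) \<Rightarrow> real \<Rightarrow> bool" where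
  "is_horton_root T w \<longleftrightarrow>
     0 < w \<and> w \<le> 1 / 2 \<and> ereal \<bar>w\<bar> < 1 / tokunaga_limsup T \<and> t_hat T w = 0"

definition horton_exponent :: "(nat \<Rightarrow> real) \<Rightarrow> real" where
  "horton_exponent T = inverse (THE w. is_horton_root T w)"

end

theory Submission
  imports Defs
begin

text \<open>
  Let \<open>m\<^sub>k s\<close> be the mean number of branches alive at time \<open>s\<close> when the root has order \<open>k\<close>, and put
  \<open>a = 1 - p\<close> and \<open>F\<^sub>z s = (\<Sum>k\<ge>1. z\<^sup>k m\<^sub>k s)\<close>. Averaging over the root order gives
  \<open>C s = (p / a) F\<^sub>a s\<close>. Conditioning on the life of the root yields the triangular system
  \<open>m\<^sub>k' = lam\<^sub>k (\<Sum>i<k. gain (k - i) m\<^sub>i - m\<^sub>k)\<close> with \<open>m\<^sub>k 0 = 1\<close>, where \<open>gain j\<close> is \<open>T j\<close>, increased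
  by 2 for \<open>j = 1\<close>: the offspring that a branch produces, counted over its whole life, together
  with the two branches into which it splits. The right-hand side is a convolution, and
  \<open>a\<^sup>k lam\<^sub>k = \<gamma> (a / \<zeta>)\<^sup>k\<close> because both the root law and the rates are geometric. Multiplying by
  \<open>a\<^sup>k\<close> and summing over \<open>k\<close> therefore turns the convolution into a product:
  \<open>F\<^sub>a' = \<gamma> t_hat (a / \<zeta>) F\<^bsub>a/\<zeta>\<^esub>\<close>. As \<open>F\<^bsub>a/\<zeta>\<^esub>\<close> is positive, the sign of \<open>t_hat (a / \<zeta>)\<close> alone
  decides whether \<open>C\<close> falls, stays at \<open>C 0 = 1\<close> or rises; since \<open>t_hat\<close> is strictly increasing and
  vanishes at \<open>w = 1 / R\<close>, that sign is the one of \<open>a / \<zeta> - 1 / R\<close>, hence of \<open>1 - \<zeta> / R - p\<close>.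

  The probabilistic part reduces \<open>C\<close> to the means \<open>m\<^sub>k\<close>. The mean number of live branches is a sum,
  over all labels, of probabilities of being alive, and the existence and the birth time of one
  branch depend only on the root order and the clocks of its ancestors, which are independent of its
  own clocks. So the
  birth-time laws propagate along each lineage: splitting convolves with an exponential law
  (\<open>at_birth_Split\<close>), and the offspring of one order, summed over their numbers, do the same up to a
  factor \<open>T j\<close> (\<open>at_birth_sum_Side\<close>), because the Erlang densities of the epochs of a Poisson process
  add up to its constant intensity. The functions \<open>m\<^sub>k\<close>, constructed directly as solutions of the
  system, satisfy the corresponding renewal equation; descending generation by generation, which ends
  after fewer than \<open>k\<close> steps below a root of order \<open>k\<close>, identifies them with the mean total progeny
  (\<open>width_function_eq\<close>).

  The analytic part has to justify the summation over \<open>k\<close>. A Gronwall estimate of the partial sums of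
  \<open>F\<^sub>a\<close>, uniform in their length, gives finiteness (\<open>partial_weighted_size_le\<close>). The differential
  equation for \<open>F\<^sub>a\<close> is used in integrated form (\<open>weighted_size_balance\<close>), with gains and losses kept
  on opposite sides, so that all terms are nonnegative and sums and integrals commute.
\<close>

section \<open>Independence of families of clocks\<close>

text \<open>
  The information carried by the variables \<open>Y v\<close>, \<open>v \<in> A\<close>, taken as a measure space so that
  measurability with respect to it can be established by the usual rules.
\<close>
definition (in prob_space) generated_algebra :: "('i \<Rightarrow> 'a \<Rightarrow> real) \<Rightarrow> 'i set \<Rightarrow> 'a measure" where
  "generated_algebra Y A = sigma (space M) (\<Union>v\<in>A. {Y v -` S \<inter> space M | S. S \<in> sets borel})"

context prob_space
begin

lemma space_generated_algebra [simp]: "space (generated_algebra Y A) = space M"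
  unfolding generated_algebra_def by (rule space_measure_of) auto

lemma sets_generated_algebra: "sets (generated_algebra Y A) = sigma_sets (space M) (\<Union>v\<in>A. {Y v -` S \<inter> space M | S. S \<in> sets borel})"
  unfolding generated_algebra_def by (rule sets_measure_of) auto

lemma measurable_generated_algebra: "v \<in> A \<Longrightarrow> Y v \<in> borel_measurable (generated_algebra Y A)"
  by (rule measurableI) (auto simp: sets_generated_algebra intro!: sigma_sets.Basic)

lemma generated_algebra_subset_events:
  assumes "\<And>v. v \<in> A \<Longrightarrow> Y v \<in> borel_measurable M"
  shows "sets (generated_algebra Y A) \<subseteq> events"
  unfolding sets_generated_algebra by (rule sets.sigma_sets_subset) (auto intro!: measurable_sets[OF assms])

lemma random_variable_generated_algebra:
  assumes "U \<in> measurable (generated_algebra Y A) N" "\<And>v. v \<in> A \<Longrightarrow> Y v \<in> borel_measurable M"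
  shows "random_variable N U"
  using assms(1) generated_algebra_subset_events[of A Y, OF assms(2)] by (auto simp: measurable_def)

text \<open>
  Grouping lemma: disjoint blocks of an independent family stay independent, since the preimages of
  Borel sets under one variable are stable under intersection.
\<close>
lemma indep_set_generated_algebra:
  assumes Y: "indep_vars (\<lambda>_. borel) Y I" and AB: "A \<union> B \<subseteq> I" "A \<inter> B = {}"
  shows "indep_set (sets (generated_algebra Y A)) (sets (generated_algebra Y B))"
proof -
  let ?E = "\<lambda>v. {Y v -` S \<inter> space M | S. S \<in> sets borel}"
  have "indep_sets (\<lambda>j. sigma_sets (space M) (\<Union>v\<in>case_bool A B j. ?E v)) UNIV"
  proof (rule indep_sets_collect_sigma)
    have "indep_sets ?E I" using Y by (simp add: indep_vars_def2)
    then show "indep_sets ?E (\<Union>j\<in>UNIV. case_bool A B j)"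
      by (rule indep_sets_mono_index[rotated]) (use AB in \<open>auto split: bool.splits\<close>)
    show "disjoint_family_on (case_bool A B) UNIV"
      using AB by (auto simp: disjoint_family_on_def split: bool.splits)
    show "Int_stable (?E i)" for i
      by (auto simp: Int_stable_def) (metis Int_assoc Int_left_commute sets.Int vimage_Int Int_absorb)
  qed
  then show ?thesis
    unfolding indep_set_def sets_generated_algebra
    by (rule back_subst[where P="\<lambda>f. indep_sets f UNIV"]) (auto split: bool.splits)
qed

text \<open>
  A variable with a density that only depends on the block \<open>B\<close> can be integrated out first while
  everything determined by the block \<open>A\<close> is held fixed. This is the form in which independence of
  the clocks is used throughout.
\<close>
lemma nn_integral_indep_density:
  assumes Y: "indep_vars (\<lambda>_. borel) Y I" and AB: "A \<union> B \<subseteq> I" "A \<inter> B = {}"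
    and U: "U \<in> measurable (generated_algebra Y A) N" and V: "V \<in> borel_measurable (generated_algebra Y B)"
    and dens: "distributed M lborel V d"
    and H [measurable]: "H \<in> borel_measurable (N \<Otimes>\<^sub>M borel)"
  shows "(\<integral>\<^sup>+\<omega>. H (U \<omega>, V \<omega>) \<partial>M) = (\<integral>\<^sup>+\<omega>. (\<integral>\<^sup>+u. d u * H (U \<omega>, u) \<partial>lborel) \<partial>M)"
proof -
  have "Y v \<in> borel_measurable M" if "v \<in> I" for v
    using Y that by (auto simp: indep_vars_def)
  then have U_meas [measurable]: "random_variable N U" and V_meas [measurable]: "random_variable borel V"
    using random_variable_generated_algebra[OF U] random_variable_generated_algebra[OF V] AB by auto
  interpret U: prob_space "distr M N U" by (rule prob_space_distr) measurable
  interpret V: prob_space "distr M borel V" by (rule prob_space_distr) measurable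
  \<comment> \<open>\<open>U\<close> and \<open>V\<close> may have different value types, so the product law is checked on rectangles.\<close>
  have joint: "distr M N U \<Otimes>\<^sub>M distr M borel V = distr M (N \<Otimes>\<^sub>M borel) (\<lambda>\<omega>. (U \<omega>, V \<omega>))"
  proof (rule pair_measure_eqI)
    fix P Q assume "P \<in> sets (distr M N U)" and "Q \<in> sets (distr M borel V)"
    then have PQ [measurable]: "P \<in> sets N" "Q \<in> sets borel" by auto
    have "(\<lambda>\<omega>. (U \<omega>, V \<omega>)) -` (P \<times> Q) \<inter> space M = (U -` P \<inter> space M) \<inter> (V -` Q \<inter> space M)"
      by auto
    moreover have "prob ((U -` P \<inter> space M) \<inter> (V -` Q \<inter> space M))
        = prob (U -` P \<inter> space M) * prob (V -` Q \<inter> space M)"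
      using indep_set_generated_algebra[OF Y AB] measurable_sets[OF U PQ(1)] measurable_sets[OF V PQ(2)]
      by (auto simp: indep_sets2_eq)
    ultimately show "emeasure (distr M N U) P * emeasure (distr M borel V) Q
        = emeasure (distr M (N \<Otimes>\<^sub>M borel) (\<lambda>\<omega>. (U \<omega>, V \<omega>))) (P \<times> Q)"
      by (simp add: emeasure_distr emeasure_eq_measure ennreal_mult)
  qed (auto intro: U.sigma_finite_measure_axioms V.sigma_finite_measure_axioms)
  have d [measurable]: "d \<in> borel_measurable borel"
    using dens by (auto simp: distributed_def)
  have "(\<integral>\<^sup>+\<omega>. H (U \<omega>, V \<omega>) \<partial>M) = (\<integral>\<^sup>+z. H z \<partial>distr M (N \<Otimes>\<^sub>M borel) (\<lambda>\<omega>. (U \<omega>, V \<omega>)))"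
    by (simp add: nn_integral_distr)
  also have "\<dots> = (\<integral>\<^sup>+x. \<integral>\<^sup>+u. H (x, u) \<partial>distr M borel V \<partial>distr M N U)"
    unfolding joint[symmetric] by (rule V.nn_integral_fst[symmetric]) simp
  also have "\<dots> = (\<integral>\<^sup>+\<omega>. \<integral>\<^sup>+u. H (U \<omega>, u) \<partial>distr M borel V \<partial>M)"
    by (subst nn_integral_distr) (auto intro!: V.borel_measurable_nn_integral_fst)
  also have "\<dots> = (\<integral>\<^sup>+\<omega>. (\<integral>\<^sup>+u. d u * H (U \<omega>, u) \<partial>lborel) \<partial>M)"
  proof (rule nn_integral_cong)
    fix \<omega> assume [simp]: "\<omega> \<in> space M"
    have [measurable]: "U \<omega> \<in> space N" using measurable_space[OF U_meas] by simp
    have "(\<integral>\<^sup>+u. H (U \<omega>, u) \<partial>distr M borel V) = (\<integral>\<^sup>+\<omega>'. H (U \<omega>, V \<omega>') \<partial>M)"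
      by (rule nn_integral_distr) measurable
    also have "\<dots> = (\<integral>\<^sup>+u. d u * H (U \<omega>, u) \<partial>lborel)"
      by (rule distributed_nn_integral[OF dens, symmetric]) measurable
    finally show "(\<integral>\<^sup>+u. H (U \<omega>, u) \<partial>distr M borel V) = (\<integral>\<^sup>+u. d u * H (U \<omega>, u) \<partial>lborel)" .
  qed
  finally show ?thesis .
qed

end

section \<open>Birth times and lineages\<close>

fun clock_owner :: "clock \<Rightarrow> branch" where
  "clock_owner (Life b) = b"
| "clock_owner (Gap b i n) = b"

text \<open>
  The clocks on which the existence and the birth time of a branch depend. They all belong to proper
  ancestors, whence a branch finds its own clocks fresh.
\<close>
fun past_clocks :: "branch \<Rightarrow> clock set" where
  "past_clocks (Root k) = {}"
| "past_clocks (Side b i n) = past_clocks b \<union> {Life b} \<union> Gap b i ` {..n}"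
| "past_clocks (Split b c) = past_clocks b \<union> {Life b}"

lemma size_clock_owner_past: "c \<in> past_clocks b \<Longrightarrow> size (clock_owner c) < size b"
  by (induction b) auto

lemma own_clocks_not_past: "Life b \<notin> past_clocks b" "Gap b i n \<notin> past_clocks b"
  using size_clock_owner_past by fastforce+

lemma past_clocks_subset: "possible T b \<Longrightarrow> past_clocks b \<subseteq> clocks T"
  by (induction b) (auto simp: clocks_def)

lemma order_pos: "possible T b \<Longrightarrow> 1 \<le> branch_order b"
  by (induction b) auto

lemma occurs_imp_possible: "occurs T K x b \<Longrightarrow> possible T b"
  by (cases b) auto

context hierarchical_branching_process
begin

text \<open>
  The root order and all clocks as one family indexed by \<open>clock option\<close>, as in the independence
  assumption of the locale.
\<close>
definition source :: "clock option \<Rightarrow> 'w \<Rightarrow> real" where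
  "source v = (case v of None \<Rightarrow> (\<lambda>\<omega>. real (K \<omega>)) | Some c \<Rightarrow> X c)"

abbreviation "sources \<equiv> insert None (Some ` clocks T)"

abbreviation occ :: "branch \<Rightarrow> 'w \<Rightarrow> bool" where
  "occ b \<omega> \<equiv> occurs T (K \<omega>) (\<lambda>c. X c \<omega>) b"

abbreviation birth :: "branch \<Rightarrow> 'w \<Rightarrow> real" where
  "birth b \<omega> \<equiv> birth_time (\<lambda>c. X c \<omega>) b"

lemma source_simps [simp]: "source None = (\<lambda>\<omega>. real (K \<omega>))" "source (Some c) = X c"
  by (simp_all add: source_def)

lemma indep_sources: "indep_vars (\<lambda>_. borel) source sources"
  using all_independent unfolding source_def .

lemma source_measurable: "v \<in> sources \<Longrightarrow> source v \<in> borel_measurable M"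
  using indep_sources by (auto simp: indep_vars_def)

text \<open>
  Existence and birth time of a branch are functions of the root order and of the clocks of its
  ancestors. The set \<open>A\<close> is arbitrary so that further clocks can be included in the same block.
\<close>
lemma measurable_birth_occ:
  assumes "possible T b" "insert None (Some ` past_clocks b) \<subseteq> A"
  shows "birth b \<in> borel_measurable (generated_algebra source A)"
    and "Measurable.pred (generated_algebra source A) (occ b)"
proof -
  have X [measurable]: "X c \<in> borel_measurable (generated_algebra source A)" if "c \<in> past_clocks b" for c
    using measurable_generated_algebra[of "Some c" A source] assms(2) that by auto
  have K: "(\<lambda>\<omega>. real (K \<omega>)) \<in> borel_measurable (generated_algebra source A)"
    using measurable_generated_algebra[of None A source] assms(2) by auto
  have "birth b' \<in> borel_measurable (generated_algebra source A) \<and> Measurable.pred (generated_algebra source A) (occ b')"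
    if "past_clocks b' \<subseteq> past_clocks b" for b'
    using that
  proof (induction b')
    case (Root k)
      have "{\<omega> \<in> space M. K \<omega> = k} = (\<lambda>\<omega>. real (K \<omega>)) -` {real k} \<inter> space (generated_algebra source A)"
        by auto
      then have "{\<omega> \<in> space M. K \<omega> = k} \<in> sets (generated_algebra source A)"
        using measurable_sets[OF K, of "{real k}"] by simp
      moreover have "{\<omega> \<in> space M. k = K \<omega>} = {\<omega> \<in> space M. K \<omega> = k}" by auto
      ultimately have "Measurable.pred (generated_algebra source A) (\<lambda>\<omega>. k = K \<omega>)"
        by (simp add: Measurable.pred_def)
      then show ?case by simp
  next
    case (Side b' i n)
    have [measurable]: "X (Gap b' i m) \<in> borel_measurable (generated_algebra source A)" if "m \<le> n" for m
      by (rule X) (use that Side.prems in auto)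
    have [measurable]: "X (Life b') \<in> borel_measurable (generated_algebra source A)"
      by (rule X) (use Side.prems in auto)
    have [measurable]: "birth b' \<in> borel_measurable (generated_algebra source A)" "Measurable.pred (generated_algebra source A) (occ b')"
      using Side by auto
    have [measurable]: "(\<lambda>\<omega>. \<Sum>m\<le>n. X (Gap b' i m) \<omega>) \<in> borel_measurable (generated_algebra source A)"
      by (rule borel_measurable_sum) auto
    show ?case by simp
  next
    case (Split b' c)
    have [measurable]: "X (Life b') \<in> borel_measurable (generated_algebra source A)"
      by (rule X) (use Split.prems in auto)
    have [measurable]: "birth b' \<in> borel_measurable (generated_algebra source A)" "Measurable.pred (generated_algebra source A) (occ b')"
      using Split by auto
    show ?case by simp
  qed
  then show "birth b \<in> borel_measurable (generated_algebra source A)" "Measurable.pred (generated_algebra source A) (occ b)"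
    by auto
qed

end

text \<open>The mean of \<open>f\<close> after an exponential waiting time that starts at \<open>t\<close>.\<close>
definition exp_step :: "real \<Rightarrow> (real \<Rightarrow> ennreal) \<Rightarrow> real \<Rightarrow> ennreal" where
  "exp_step l f t = (\<integral>\<^sup>+u. ennreal (exponential_density l u) * f (t + u) \<partial>lborel)"

lemma exponential_tail:
  assumes "0 < l" "0 \<le> r"
  shows "(\<integral>\<^sup>+u. ennreal (exponential_density l u) * indicator {r<..} u \<partial>lborel) = ennreal (exp (- l * r))"
proof -
  let ?D = "density lborel (exponential_density l)"
  interpret prob_space ?D by (rule prob_space_exponential_density) fact
  have "distributed ?D lborel (\<lambda>u. u) (exponential_density l)"
    by (auto simp: distributed_def distr_id2)
  from exponential_distributedD_gt[OF this assms(2,1)]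
  have "emeasure ?D {r<..} = ennreal (exp (- l * r))"
    by (simp add: emeasure_eq_measure greaterThan_def mult.commute)
  then show ?thesis by (simp add: emeasure_density)
qed

lemma exp_step_measurable [measurable]:
  assumes [measurable]: "f \<in> borel_measurable borel"
  shows "exp_step l f \<in> borel_measurable borel"
  unfolding exp_step_def by measurable

text \<open>
  The sum over \<open>n\<close> of the densities of the \<open>n\<close>-th epoch of a Poisson process is its intensity; the
  computation is the exponential series.
\<close>
lemma suminf_erlang_density:
  assumes "0 < l"
  shows "(\<Sum>n. ennreal (erlang_density n l u)) = (if u < 0 then 0 else ennreal l)"
proof (cases "u < 0")
  case True then show ?thesis by (simp add: erlang_density_def)
next
  case False
  have "(\<lambda>n. (l * exp (- l * u)) * ((l * u) ^ n /\<^sub>R fact n)) sums ((l * exp (- l * u)) * exp (l * u))"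
    by (intro sums_mult exp_converges)
  moreover have "(l * exp (- l * u)) * ((l * u) ^ n /\<^sub>R fact n) = erlang_density n l u" for n
    using False by (simp add: erlang_density_def power_mult_distrib divide_inverse mult_ac)
  ultimately have "(\<lambda>n. erlang_density n l u) sums l"
    by (simp add: mult.assoc exp_add[symmetric])
  then show ?thesis
    using False assms by (subst suminf_ennreal2) (auto simp: sums_iff)
qed

context hierarchical_branching_process
begin

text \<open>
  Integration against the law of the birth time of \<open>b\<close>, a measure whose total mass is the probability
  that \<open>b\<close> occurs. All means below are expressed through this functional.
\<close>
definition at_birth :: "branch \<Rightarrow> (real \<Rightarrow> ennreal) \<Rightarrow> ennreal" where
  "at_birth b f = (\<integral>\<^sup>+\<omega>. (if occ b \<omega> then f (birth b \<omega>) else 0) \<partial>M)"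

lemma random_variable_birth_occ:
  assumes "possible T b"
  shows "random_variable borel (birth b)" and "Measurable.pred M (occ b)"
proof -
  have "insert None (Some ` past_clocks b) \<subseteq> sources"
    using past_clocks_subset[OF assms] by auto
  then have *: "source v \<in> borel_measurable M" if "v \<in> insert None (Some ` past_clocks b)" for v
    using source_measurable that by auto
  show "random_variable borel (birth b)"
    by (rule random_variable_generated_algebra[OF measurable_birth_occ(1)[OF assms order_refl] *])
  show "Measurable.pred M (occ b)"
    by (rule random_variable_generated_algebra[OF measurable_birth_occ(2)[OF assms order_refl] *])
qed

lemma at_birth_impossible: "\<not> possible T b \<Longrightarrow> at_birth b f = 0"
proof -
  assume "\<not> possible T b"
  then have "\<not> occ b \<omega>" for \<omega> using occurs_imp_possible by blast
  then show ?thesis by (simp add: at_birth_def)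
qed

lemma at_birth_sum:
  assumes "\<And>n. F n \<in> borel_measurable borel"
  shows "at_birth b (\<lambda>t. \<Sum>n. F n t) = (\<Sum>n. at_birth b (F n))"
proof (cases "possible T b")
  case True
  note [measurable] = assms random_variable_birth_occ[OF True]
  have "at_birth b (\<lambda>t. \<Sum>n. F n t) = (\<integral>\<^sup>+\<omega>. (\<Sum>n. if occ b \<omega> then F n (birth b \<omega>) else 0) \<partial>M)"
    unfolding at_birth_def by (intro nn_integral_cong) auto
  also have "\<dots> = (\<Sum>n. at_birth b (F n))"
    unfolding at_birth_def by (rule nn_integral_suminf) measurable
  finally show ?thesis .
qed (simp add: at_birth_impossible)

lemma at_birth_Root:
  assumes "1 \<le> k"
  shows "at_birth (Root k) f = ennreal (pr k) * f 0"
proof -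
  have [measurable]: "{\<omega> \<in> space M. K \<omega> = k} \<in> events"
    using K_measurable by measurable
  have "at_birth (Root k) f = (\<integral>\<^sup>+\<omega>. f 0 * indicator {\<omega> \<in> space M. K \<omega> = k} \<omega> \<partial>M)"
    unfolding at_birth_def using assms by (intro nn_integral_cong) (auto simp: indicator_def)
  also have "\<dots> = f 0 * ennreal (prob {\<omega> \<in> space M. K \<omega> = k})"
    by (subst nn_integral_cmult_indicator) (auto simp: emeasure_eq_measure)
  finally show ?thesis using root_order[OF assms] by (simp add: mult.commute)
qed

text \<open>The Markov property at the birth of \<open>b\<close>: what uses only clocks not in its past restarts afresh.\<close>
lemma at_birth_fresh:
  fixes V :: "'w \<Rightarrow> real"
  assumes b: "possible T b" and B: "B \<subseteq> clocks T" "past_clocks b \<inter> B = {}"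
    and V: "V \<in> borel_measurable (generated_algebra source (Some ` B))" "distributed M lborel V d"
    and H [measurable]: "H \<in> borel_measurable (borel \<Otimes>\<^sub>M borel)"
  shows "(\<integral>\<^sup>+\<omega>. (if occ b \<omega> then H (birth b \<omega>, V \<omega>) else 0) \<partial>M)
       = at_birth b (\<lambda>t. \<integral>\<^sup>+u. d u * H (t, u) \<partial>lborel)"
proof -
  let ?A = "insert None (Some ` past_clocks b)"
  let ?U = "\<lambda>\<omega>. (occ b \<omega>, birth b \<omega>)"
  let ?H = "\<lambda>z. if fst (fst z) then H (snd (fst z), snd z) else (0 :: ennreal)"
  have AB: "?A \<union> Some ` B \<subseteq> sources" "?A \<inter> Some ` B = {}"
    using past_clocks_subset[OF b] B by auto
  have U: "?U \<in> generated_algebra source ?A \<rightarrow>\<^sub>M count_space UNIV \<Otimes>\<^sub>M borel"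
    using measurable_birth_occ[OF b order_refl] by measurable
  have [measurable]: "?H \<in> borel_measurable ((count_space UNIV \<Otimes>\<^sub>M borel) \<Otimes>\<^sub>M borel)"
    by measurable
  from nn_integral_indep_density[OF indep_sources AB U V this]
  have "(\<integral>\<^sup>+\<omega>. (if occ b \<omega> then H (birth b \<omega>, V \<omega>) else 0) \<partial>M)
      = (\<integral>\<^sup>+\<omega>. (\<integral>\<^sup>+u. d u * (if occ b \<omega> then H (birth b \<omega>, u) else 0) \<partial>lborel) \<partial>M)"
    by (simp only: fst_conv snd_conv)
  also have "\<dots> = at_birth b (\<lambda>t. \<integral>\<^sup>+u. d u * H (t, u) \<partial>lborel)"
    unfolding at_birth_def by (intro nn_integral_cong) auto
  finally show ?thesis .
qed

lemma Life_fresh: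
  assumes "possible T b"
  shows "{Life b} \<subseteq> clocks T" "X (Life b) \<in> borel_measurable (generated_algebra source (Some ` {Life b}))"
    "distributed M lborel (X (Life b)) (exponential_density (lam (branch_order b)))"
  using assms clock_exponential[of "Life b"] measurable_generated_algebra[of "Some (Life b)" "Some ` {Life b}" source]
  by (auto simp: clocks_def)

lemma at_birth_Split:
  assumes "possible T (Split b c)" and [measurable]: "f \<in> borel_measurable borel"
  shows "at_birth (Split b c) f = at_birth b (exp_step (lam (branch_order b)) f)"
proof -
  have b: "possible T b" using assms(1) by simp
  have "at_birth (Split b c) f = (\<integral>\<^sup>+\<omega>. (if occ b \<omega> then (case (birth b \<omega>, X (Life b) \<omega>) of (t, u) \<Rightarrow> f (t + u)) else 0) \<partial>M)"
    unfolding at_birth_def using assms(1) by (intro nn_integral_cong) auto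
  also have "\<dots> = at_birth b (\<lambda>t. \<integral>\<^sup>+u. exponential_density (lam (branch_order b)) u * (case (t, u) of (t, u) \<Rightarrow> f (t + u)) \<partial>lborel)"
    using Life_fresh[OF b] own_clocks_not_past(1)[of b] by (intro at_birth_fresh[OF b, of "{Life b}"]) auto
  finally show ?thesis by (simp add: exp_step_def[abs_def])
qed

text \<open>Once born by time \<open>s\<close>, a branch is alive at \<open>s\<close> iff its exponential lifetime exceeds its age \<open>s - t\<close>.\<close>
lemma mean_alive:
  assumes b: "possible T b"
  shows "(\<integral>\<^sup>+\<omega>. (if alive_at T (K \<omega>) (\<lambda>c. X c \<omega>) s b then 1 else 0) \<partial>M)
       = at_birth b (\<lambda>t. if t \<le> s then ennreal (exp (- lam (branch_order b) * (s - t))) else 0)"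
proof -
  let ?l = "lam (branch_order b)"
  let ?H = "\<lambda>(t, u). if t \<le> s \<and> s < t + u then 1 else (0 :: ennreal)"
  have l: "0 < ?l" using lam_pos order_pos[OF b] by simp
  have "(\<integral>\<^sup>+\<omega>. (if alive_at T (K \<omega>) (\<lambda>c. X c \<omega>) s b then 1 else 0) \<partial>M)
      = (\<integral>\<^sup>+\<omega>. (if occ b \<omega> then ?H (birth b \<omega>, X (Life b) \<omega>) else 0) \<partial>M)"
    by (intro nn_integral_cong) (auto simp: alive_at_def)
  also have "\<dots> = at_birth b (\<lambda>t. \<integral>\<^sup>+u. exponential_density ?l u * ?H (t, u) \<partial>lborel)"
    using Life_fresh[OF b] own_clocks_not_past(1)[of b] by (intro at_birth_fresh[OF b, of "{Life b}"]) auto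
  also have "(\<lambda>t. \<integral>\<^sup>+u. exponential_density ?l u * ?H (t, u) \<partial>lborel)
      = (\<lambda>t. if t \<le> s then ennreal (exp (- ?l * (s - t))) else 0)"
  proof
    fix t
    show "(\<integral>\<^sup>+u. exponential_density ?l u * ?H (t, u) \<partial>lborel) = (if t \<le> s then ennreal (exp (- ?l * (s - t))) else 0)"
    proof (cases "t \<le> s")
      case True
      then have "(\<integral>\<^sup>+u. exponential_density ?l u * ?H (t, u) \<partial>lborel)
        = (\<integral>\<^sup>+u. ennreal (exponential_density ?l u) * indicator {s - t<..} u \<partial>lborel)"
        by (intro nn_integral_cong) (auto simp: indicator_def)
      then show ?thesis using exponential_tail[OF l, of "s - t"] True by simp
    qed simp
  qed
  finally show ?thesis .
qed

lemma offspring_epoch: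
  assumes "possible T (Side b i n)"
  shows "(\<lambda>\<omega>. \<Sum>m\<le>n. X (Gap b i m) \<omega>) \<in> borel_measurable (generated_algebra source (Some ` Gap b i ` {..n}))"
    and "distributed M lborel (\<lambda>\<omega>. \<Sum>m\<le>n. X (Gap b i m) \<omega>)
      (erlang_density n (lam (branch_order b) * T (branch_order b - i)))"
proof -
  have [measurable]: "X (Gap b i m) \<in> borel_measurable (generated_algebra source (Some ` Gap b i ` {..n}))" if "m \<le> n" for m
    using measurable_generated_algebra[of "Some (Gap b i m)" _ source] that by auto
  show "(\<lambda>\<omega>. \<Sum>m\<le>n. X (Gap b i m) \<omega>) \<in> borel_measurable (generated_algebra source (Some ` Gap b i ` {..n}))"
    by (rule borel_measurable_sum) auto
  have gap: "Gap b i m \<in> clocks T" for m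
    using assms by (auto simp: clocks_def)
  let ?I = "(\<lambda>m. Some (Gap b i m)) ` {..n}"
  have inj: "inj_on (\<lambda>m. Some (Gap b i m)) {..n}" by (auto simp: inj_on_def)
  have "distributed M lborel (\<lambda>\<omega>. \<Sum>v\<in>?I. source v \<omega>)
      (erlang_density (card ?I - 1) (lam (branch_order b) * T (branch_order b - i)))"
  proof (rule exponential_distributed_sum)
    show "indep_vars (\<lambda>_. borel) source ?I"
      by (rule indep_vars_subset[OF indep_sources]) (use gap in auto)
    show "0 < lam (branch_order b) * T (branch_order b - i)"
      using assms lam_pos order_pos[of T b] by simp
  qed (use clock_exponential[OF gap] in auto)
  then show "distributed M lborel (\<lambda>\<omega>. \<Sum>m\<le>n. X (Gap b i m) \<omega>)
      (erlang_density n (lam (branch_order b) * T (branch_order b - i)))"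
    by (simp add: sum.reindex[OF inj] card_image[OF inj])
qed

text \<open>
  The \<open>n\<close>-th offspring appears after an Erlang time \<open>u\<close>, provided that the parent is still alive then.
  Two clocks are integrated out in turn: the lifetime of the parent, which contributes the survival
  probability \<open>exp (- l * u)\<close>, and then the epoch itself.
\<close>
lemma at_birth_Side:
  assumes ps: "possible T (Side b i n)" and [measurable]: "f \<in> borel_measurable borel"
  defines "l \<equiv> lam (branch_order b)" and "r \<equiv> lam (branch_order b) * T (branch_order b - i)"
  shows "at_birth (Side b i n) f
    = at_birth b (\<lambda>t. \<integral>\<^sup>+u. erlang_density n r u * (ennreal (exp (- l * u)) * f (t + u)) \<partial>lborel)"
proof -
  have b: "possible T b" using ps by simp
  have l: "0 < l" using lam_pos order_pos[OF b] by (simp add: l_def)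
  define S where "S \<omega> = (\<Sum>m\<le>n. X (Gap b i m) \<omega>)" for \<omega>
  note S = offspring_epoch[OF ps, folded S_def[abs_def] r_def]
  define tail where "tail v = (\<integral>\<^sup>+u. ennreal (exponential_density l u) * indicator {v<..} u \<partial>lborel)" for v
  have [measurable]: "(\<lambda>(v::real, u). indicator {v<..} u :: ennreal) \<in> borel_measurable (borel \<Otimes>\<^sub>M borel)"
  proof -
    have "(\<lambda>(v::real, u). indicator {v<..} u :: ennreal) = (\<lambda>(v, u). if v < u then 1 else 0)"
      by (auto simp: indicator_def)
    then show ?thesis by simp
  qed
  have tail_measurable [measurable]: "tail \<in> borel_measurable borel"
    unfolding tail_def by measurable
  let ?A = "insert None (Some ` past_clocks b) \<union> Some ` Gap b i ` {..n}"
  let ?U = "\<lambda>\<omega>. ((occ b \<omega>, birth b \<omega>), S \<omega>)"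
  let ?N = "(count_space UNIV \<Otimes>\<^sub>M borel) \<Otimes>\<^sub>M borel"
  let ?H = "\<lambda>z :: ((bool \<times> real) \<times> real) \<times> real. if fst (fst (fst z)) \<and> snd (fst z) < snd z
    then f (snd (fst (fst z)) + snd (fst z)) else 0"
  have "Gap b i ` {..n} \<subseteq> clocks T" using ps by (auto simp: clocks_def)
  then have AB: "?A \<union> Some ` {Life b} \<subseteq> sources" "?A \<inter> Some ` {Life b} = {}"
    using past_clocks_subset[OF b] Life_fresh(1)[OF b] own_clocks_not_past(1)[of b] by auto
  have U: "?U \<in> generated_algebra source ?A \<rightarrow>\<^sub>M ?N"
  proof -
    have [measurable]: "birth b \<in> borel_measurable (generated_algebra source ?A)" "Measurable.pred (generated_algebra source ?A) (occ b)"
      by (rule measurable_birth_occ[OF b]; blast)+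
    have "X (Gap b i m) \<in> borel_measurable (generated_algebra source ?A)" if "m \<le> n" for m
      using measurable_generated_algebra[of "Some (Gap b i m)" ?A source] that by auto
    then have [measurable]: "S \<in> borel_measurable (generated_algebra source ?A)"
      unfolding S_def[abs_def] by (intro borel_measurable_sum) auto
    show ?thesis by measurable
  qed
  \<comment> \<open>\<open>?U\<close> collects everything that has to be kept fixed while the lifetime is integrated out.\<close>
  have "at_birth (Side b i n) f = (\<integral>\<^sup>+\<omega>. ?H (?U \<omega>, X (Life b) \<omega>) \<partial>M)"
    unfolding at_birth_def using ps by (intro nn_integral_cong) (auto simp: S_def)
  also have "\<dots> = (\<integral>\<^sup>+\<omega>. (\<integral>\<^sup>+u. exponential_density l u * ?H (?U \<omega>, u) \<partial>lborel) \<partial>M)"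
    unfolding l_def by (rule nn_integral_indep_density[OF indep_sources AB U Life_fresh(2,3)[OF b]]) measurable
  also have "\<dots> = (\<integral>\<^sup>+\<omega>. (if occ b \<omega> then (case (birth b \<omega>, S \<omega>) of (t, v) \<Rightarrow> tail v * f (t + v)) else 0) \<partial>M)"
  proof (rule nn_integral_cong)
    fix \<omega>
    have "(\<integral>\<^sup>+u. exponential_density l u * ?H (?U \<omega>, u) \<partial>lborel)
      = (\<integral>\<^sup>+u. (ennreal (exponential_density l u) * indicator {S \<omega><..} u) * (if occ b \<omega> then f (birth b \<omega> + S \<omega>) else 0) \<partial>lborel)"
      by (intro nn_integral_cong) (auto simp: indicator_def)
    also have "\<dots> = tail (S \<omega>) * (if occ b \<omega> then f (birth b \<omega> + S \<omega>) else 0)"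
      unfolding tail_def by (rule nn_integral_multc) measurable
    finally show "(\<integral>\<^sup>+u. exponential_density l u * ?H (?U \<omega>, u) \<partial>lborel)
      = (if occ b \<omega> then (case (birth b \<omega>, S \<omega>) of (t, v) \<Rightarrow> tail v * f (t + v)) else 0)" by auto
  qed
  also have "\<dots> = at_birth b (\<lambda>t. \<integral>\<^sup>+v. erlang_density n r v * (case (t, v) of (t, v) \<Rightarrow> tail v * f (t + v)) \<partial>lborel)"
    by (rule at_birth_fresh[OF b _ _ S])
      (use ps own_clocks_not_past(2)[of b i] in \<open>auto simp: clocks_def\<close>)
  also have "\<dots> = at_birth b (\<lambda>t. \<integral>\<^sup>+u. erlang_density n r u * (ennreal (exp (- l * u)) * f (t + u)) \<partial>lborel)"
  proof -
    \<comment> \<open>\<open>tail\<close> has its exponential form only at nonnegative times; elsewhere the density vanishes.\<close>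
    have "ennreal (erlang_density n r u) * (tail u * f (t + u))
        = ennreal (erlang_density n r u) * (ennreal (exp (- l * u)) * f (t + u))" for t u
      using exponential_tail[OF l, of u] by (cases "u < 0") (auto simp: erlang_density_def tail_def)
    then show ?thesis by simp
  qed
  finally show ?thesis .
qed

text \<open>
  Summed over all offspring of one order, births form a Poisson stream of constant rate
  \<open>lam \<cdot> T\<close> thinned by the survival of the parent. The resulting intensity \<open>lam T exp (- lam u)\<close> is
  \<open>T\<close> times the density of the lifetime, so that on average side branching acts as if \<open>T\<close> branches
  were born at the moment of termination.
\<close>
lemma at_birth_sum_Side:
  assumes i: "1 \<le> i" "i < branch_order b" and [measurable]: "f \<in> borel_measurable borel"
  shows "(\<Sum>n. at_birth (Side b i n) f)
    = at_birth b (\<lambda>t. ennreal (T (branch_order b - i)) * exp_step (lam (branch_order b)) f t)"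
proof (cases "possible T b \<and> 0 < T (branch_order b - i)")
  case True
  let ?l = "lam (branch_order b)" and ?T = "T (branch_order b - i)"
  have ps: "possible T (Side b i n)" for n using True i by simp
  have l: "0 < ?l" using lam_pos order_pos[of T b] True by simp
  have "(\<Sum>n. at_birth (Side b i n) f) = at_birth b (\<lambda>t. \<Sum>n. \<integral>\<^sup>+u. erlang_density n (?l * ?T) u * (ennreal (exp (- ?l * u)) * f (t + u)) \<partial>lborel)"
    by (simp add: at_birth_Side[OF ps] at_birth_sum)
  also have "(\<lambda>t. \<Sum>n. \<integral>\<^sup>+u. erlang_density n (?l * ?T) u * (ennreal (exp (- ?l * u)) * f (t + u)) \<partial>lborel)
      = (\<lambda>t. ennreal ?T * exp_step ?l f t)"
  proof
    fix t
    have "(\<Sum>n. \<integral>\<^sup>+u. erlang_density n (?l * ?T) u * (ennreal (exp (- ?l * u)) * f (t + u)) \<partial>lborel)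
      = (\<integral>\<^sup>+u. (\<Sum>n. ennreal (erlang_density n (?l * ?T) u)) * (ennreal (exp (- ?l * u)) * f (t + u)) \<partial>lborel)"
      by (subst nn_integral_suminf[symmetric]) auto
    also have "\<dots> = (\<integral>\<^sup>+u. ennreal ?T * (exponential_density ?l u * f (t + u)) \<partial>lborel)"
    proof (rule nn_integral_cong)
      fix u
      have "(if u < 0 then 0 else ennreal (?l * ?T)) * ennreal (exp (- ?l * u))
          = ennreal ?T * ennreal (exponential_density ?l u)"
        using l True by (auto simp: exponential_density_def ennreal_mult[symmetric] mult_ac)
      then show "(\<Sum>n. ennreal (erlang_density n (?l * ?T) u)) * (ennreal (exp (- ?l * u)) * f (t + u))
          = ennreal ?T * (exponential_density ?l u * f (t + u))"
        using l True by (simp only: suminf_erlang_density mult_pos_pos mult.assoc[symmetric])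
    qed
    also have "\<dots> = ennreal ?T * exp_step ?l f t"
      unfolding exp_step_def by (rule nn_integral_cmult) measurable
    finally show "(\<Sum>n. \<integral>\<^sup>+u. erlang_density n (?l * ?T) u * (ennreal (exp (- ?l * u)) * f (t + u)) \<partial>lborel)
        = ennreal ?T * exp_step ?l f t" .
  qed
  finally show ?thesis .
next
  case False
  then have "at_birth (Side b i n) f = 0" for n by (intro at_birth_impossible) auto
  moreover have "T (branch_order b - i) = 0 \<or> \<not> possible T b"
  proof -
    have "1 \<le> branch_order b - i" using i by simp
    with T_nonneg[of "branch_order b - i"] False show ?thesis by auto
  qed
  then have "at_birth b (\<lambda>t. ennreal (T (branch_order b - i)) * exp_step (lam (branch_order b)) f t) = 0"
    using at_birth_impossible[of b] by (auto simp: at_birth_def cong: if_cong)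
  ultimately show ?thesis by simp
qed

end

section \<open>Mean progeny as the solution of a triangular linear system\<close>

text \<open>
  The mean number of branches of order \<open>j - k\<close> to which a branch of order \<open>j\<close> gives rise, by side
  branching and by its final split. Up to the diagonal these are the entries of the Toeplitz operator
  of the process.
\<close>
definition gain :: "(nat \<Rightarrow> real) \<Rightarrow> nat \<Rightarrow> real" where
  "gain T k = T k + (if k = 1 then 2 else 0)"

lemma gain_nonneg: "(\<And>k. 1 \<le> k \<Longrightarrow> 0 \<le> T k) \<Longrightarrow> 1 \<le> k \<Longrightarrow> 0 \<le> gain T k"
  by (simp add: gain_def)

text \<open>
  Variation of constants applied to \<open>m\<^sub>k' = lam\<^sub>k (\<phi>\<^sub>k - m\<^sub>k)\<close>, \<open>m\<^sub>k 0 = 1\<close>, where the inhomogeneity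
  \<open>\<phi>\<^sub>k\<close> involves lower orders only. In this form positivity and regularity are immediate by induction
  on the order.
\<close>
function mean_size :: "(nat \<Rightarrow> real) \<Rightarrow> (nat \<Rightarrow> real) \<Rightarrow> nat \<Rightarrow> real \<Rightarrow> real" where
  "mean_size T lam k s = exp (- lam k * s) * (1 + integral {0..s}
     (\<lambda>v. lam k * exp (lam k * v) * (\<Sum>i\<in>{1..<k}. gain T (k - i) * mean_size T lam i v)))"
  by pat_completeness auto
termination
  by (relation "Wellfounded.measure (\<lambda>(T, lam, k, s). k)") auto

declare mean_size.simps [simp del]

definition offspring_size :: "(nat \<Rightarrow> real) \<Rightarrow> (nat \<Rightarrow> real) \<Rightarrow> nat \<Rightarrow> real \<Rightarrow> real" where
  "offspring_size T lam k v = (\<Sum>i\<in>{1..<k}. gain T (k - i) * mean_size T lam i v)"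

lemma mean_size_eq: "mean_size T lam k s = exp (- lam k * s) *
    (1 + integral {0..s} (\<lambda>v. lam k * exp (lam k * v) * offspring_size T lam k v))"
  unfolding offspring_size_def by (rule mean_size.simps)

lemma mean_size_0 [simp]: "mean_size T lam k 0 = 1"
  by (simp add: mean_size_eq[of T lam k])

locale branching_rates =
  fixes T lam :: "nat \<Rightarrow> real"
  assumes T_nonneg: "1 \<le> k \<Longrightarrow> 0 \<le> T k"
    and lam_pos: "1 \<le> k \<Longrightarrow> 0 < lam k"
begin

abbreviation "m \<equiv> mean_size T lam"
abbreviation "\<phi> \<equiv> offspring_size T lam"

lemma mean_size_regular:
  assumes "1 \<le> k"
  shows "continuous_on {0..} (m k) \<and> (\<forall>s\<ge>0. 0 < m k s)"
  using assms
proof (induction k rule: less_induct)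
  case (less k)
  have cont: "continuous_on {0..} (\<phi> k)"
    unfolding offspring_size_def using less by (intro continuous_intros) auto
  have nonneg: "0 \<le> \<phi> k v" if "0 \<le> v" for v
    unfolding offspring_size_def
    using less that gain_nonneg[of T, OF T_nonneg] by (intro sum_nonneg mult_nonneg_nonneg) (auto intro: less_imp_le)
  let ?g = "\<lambda>v. lam k * exp (lam k * v) * \<phi> k v"
  have m: "m k = (\<lambda>s. exp (- lam k * s) * (1 + integral {0..s} ?g))"
    by (rule ext) (rule mean_size_eq)
  have g: "continuous_on {0..b} ?g" for b
    by (intro continuous_intros continuous_on_subset[OF cont]) auto
  have pos: "0 < m k s" if "0 \<le> s" for s
  proof -
    have "0 \<le> integral {0..s} ?g"
      using lam_pos[of k] less.prems nonneg by (intro integral_nonneg integrable_continuous_interval g) auto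
    then show ?thesis unfolding m by (intro mult_pos_pos) auto
  qed
  have "continuous (at s within {0..}) (m k)" if "0 \<le> s" for s
  proof -
    have "continuous_on {0..s + 1} (\<lambda>s. integral {0..s} ?g)"
      by (intro indefinite_integral_continuous_1 integrable_continuous_interval g)
    then have "continuous_on {0..s + 1} (m k)"
      unfolding m by (intro continuous_intros)
    then have "continuous (at s within {0..s + 1}) (m k)"
      using that by (auto simp: continuous_on_eq_continuous_within)
    moreover have "at s within {0..s + 1} = at s within {0..}"
      by (rule at_within_nhd[of _ "{..<s + 1}"]) auto
    ultimately show ?thesis by simp
  qed
  with pos show ?case by (auto simp: continuous_on_eq_continuous_within)
qed

lemmas mean_size_continuous = mean_size_regular[THEN conjunct1]
lemmas mean_size_pos = mean_size_regular[THEN conjunct2, rule_format]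

lemma offspring_size_continuous: "continuous_on {0..} (\<phi> k)"
  unfolding offspring_size_def by (intro continuous_intros mean_size_continuous) auto

lemma offspring_size_nonneg: "0 \<le> v \<Longrightarrow> 0 \<le> \<phi> k v"
  unfolding offspring_size_def
  using gain_nonneg[of T, OF T_nonneg] mean_size_pos
  by (intro sum_nonneg mult_nonneg_nonneg) (auto intro: less_imp_le)

lemma mean_size_deriv:
  assumes "0 \<le> s" "s \<le> b"
  shows "(m k has_real_derivative lam k * (\<phi> k s - m k s)) (at s within {0..b})"
proof -
  let ?g = "\<lambda>v. lam k * exp (lam k * v) * \<phi> k v"
  have m: "m k = (\<lambda>s. exp (- lam k * s) * (1 + integral {0..s} ?g))"
    by (rule ext) (rule mean_size_eq)
  have "continuous_on {0..b} ?g"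
    by (intro continuous_intros continuous_on_subset[OF offspring_size_continuous]) auto
  then have *: "((\<lambda>s. integral {0..s} ?g) has_real_derivative ?g s) (at s within {0..b})"
    using assms by (intro integral_has_real_derivative) auto
  have E: "((\<lambda>s. exp (- lam k * s)) has_real_derivative - lam k * exp (- lam k * s)) (at s within {0..b})"
    by (auto intro!: derivative_eq_intros)
  have "(m k has_real_derivative (- lam k * exp (- lam k * s)) * (1 + integral {0..s} ?g)
      + (0 + ?g s) * exp (- lam k * s)) (at s within {0..b})"
    unfolding m by (rule DERIV_mult[OF E DERIV_add[OF DERIV_const *]])
  moreover have "exp (lam k * s) * exp (- lam k * s) = 1"
    by (simp add: exp_add[symmetric])
  then have "(0 + ?g s) * exp (- lam k * s) = lam k * \<phi> k s"
    by (simp add: mult_ac)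
  moreover have "(- lam k * exp (- lam k * s)) * (1 + integral {0..s} ?g) = - lam k * m k s"
    by (simp only: m mult.assoc)
  ultimately have "(m k has_real_derivative - lam k * m k s + lam k * \<phi> k s) (at s within {0..b})"
    by (simp only:)
  then show ?thesis by (simp add: right_diff_distrib)
qed

text \<open>
  Conditioning on the moment \<open>u\<close> of termination: either it comes after \<open>r\<close>, or the branches that take
  over have the remaining time \<open>r - u\<close>. The integrand is the derivative in \<open>u\<close> of
  \<open>- exp (- lam u) m (r - u)\<close>.
\<close>
lemma mean_size_renewal:
  assumes "0 \<le> r" "1 \<le> k"
  shows "ennreal (m k r) = ennreal (exp (- lam k * r))
    + (\<integral>\<^sup>+u. ennreal (lam k * exp (- lam k * u) * \<phi> k (r - u)) * indicator {0..r} u \<partial>lborel)"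
proof -
  let ?F = "\<lambda>u. - (exp (- lam k * u) * m k (r - u))"
  let ?f = "\<lambda>u. lam k * exp (- lam k * u) * \<phi> k (r - u)"
  have "(?F has_real_derivative ?f u) (at u within {0..r})" if "u \<in> {0..r}" for u
  proof -
    have "((m k \<circ> (\<lambda>u. r - u)) has_real_derivative (lam k * (\<phi> k (r - u) - m k (r - u))) * (- 1)) (at u within {0..r})"
    proof (rule DERIV_image_chain)
      have "(\<lambda>u. r - u) ` {0..r} = {0..r}" by (simp add: image_diff_atLeastAtMost)
      then show "(m k has_real_derivative lam k * (\<phi> k (r - u) - m k (r - u))) (at (r - u) within (\<lambda>u. r - u) ` {0..r})"
        using mean_size_deriv[of "r - u" r k] that by simp
    qed (auto intro!: derivative_eq_intros)
    then have "((\<lambda>u. m k (r - u)) has_real_derivative (lam k * (\<phi> k (r - u) - m k (r - u))) * (- 1)) (at u within {0..r})"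
      by (simp add: o_def)
    note * = this
    have E: "((\<lambda>u. exp (- lam k * u)) has_real_derivative - lam k * exp (- lam k * u)) (at u within {0..r})"
      by (auto intro!: derivative_eq_intros)
    have "(?F has_real_derivative - ((- lam k * exp (- lam k * u)) * m k (r - u)
        + ((lam k * (\<phi> k (r - u) - m k (r - u))) * (- 1)) * exp (- lam k * u))) (at u within {0..r})"
      by (rule DERIV_minus, rule DERIV_mult, rule E, rule *)
    also have "- ((- lam k * exp (- lam k * u)) * m k (r - u)
        + ((lam k * (\<phi> k (r - u) - m k (r - u))) * (- 1)) * exp (- lam k * u)) = ?f u"
      by (simp add: algebra_simps)
    finally show ?thesis .
  qed
  then have "(?f has_integral (?F r - ?F 0)) {0..r}"
    using assms by (intro fundamental_theorem_of_calculus) (auto simp: has_real_derivative_iff_has_vector_derivative)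
  note I = this
  have "(\<integral>\<^sup>+u. ennreal (?f u) * indicator {0..r} u \<partial>lborel) = ennreal (?F r - ?F 0)"
    using assms lam_pos[of k] offspring_size_nonneg by (intro nn_integral_has_integral_lebesgue' I) auto
  moreover have "0 \<le> ?F r - ?F 0"
    by (rule has_integral_nonneg[OF I]) (use assms lam_pos[of k] offspring_size_nonneg in auto)
  then have "ennreal (exp (- lam k * r)) + ennreal (?F r - ?F 0) = ennreal (exp (- lam k * r) + (?F r - ?F 0))"
    by (intro ennreal_plus[symmetric]) auto
  then have "ennreal (m k r) = ennreal (exp (- lam k * r)) + ennreal (?F r - ?F 0)" by simp
  ultimately show ?thesis by simp
qed

text \<open>
  The differential equation integrated from \<open>s\<close> to \<open>t\<close>, without subtraction: deaths are on the left,
  births on the right. All terms are nonnegative, which is what permits summing over \<open>k\<close> later on.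
\<close>
lemma mean_size_balance:
  assumes "0 \<le> s" "s \<le> t" "1 \<le> k"
  shows "ennreal (m k t) + (\<integral>\<^sup>+v. ennreal (lam k * m k v) * indicator {s..t} v \<partial>lborel)
       = ennreal (m k s) + (\<integral>\<^sup>+v. ennreal (lam k * \<phi> k v) * indicator {s..t} v \<partial>lborel)"
proof -
  have int: "(\<integral>\<^sup>+v. ennreal (lam k * h v) * indicator {s..t} v \<partial>lborel) = ennreal (integral {s..t} (\<lambda>v. lam k * h v))
      \<and> 0 \<le> integral {s..t} (\<lambda>v. lam k * h v) \<and> (\<lambda>v. lam k * h v) integrable_on {s..t}"
    if "continuous_on {0..} h" "\<And>v. 0 \<le> v \<Longrightarrow> 0 \<le> h v" for h
  proof -
    have *: "(\<lambda>v. lam k * h v) integrable_on {s..t}"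
      using assms by (intro integrable_continuous_interval continuous_intros continuous_on_subset[OF that(1)]) auto
    have pos: "0 \<le> lam k * h v" if "v \<in> {s..t}" for v
      using assms lam_pos[of k] that(1) \<open>\<And>v. 0 \<le> v \<Longrightarrow> 0 \<le> h v\<close>[of v] by simp
    show ?thesis
      using nn_integral_has_integral_lebesgue'[OF pos integrable_integral[OF *]] integral_nonneg[OF * pos] *
      by blast
  qed
  define A where "A = integral {s..t} (\<lambda>v. lam k * \<phi> k v)"
  define B where "B = integral {s..t} (\<lambda>v. lam k * m k v)"
  note A = int[OF offspring_size_continuous[of k] offspring_size_nonneg, folded A_def]
  have B: "(\<integral>\<^sup>+v. ennreal (lam k * m k v) * indicator {s..t} v \<partial>lborel) = ennreal B \<and> 0 \<le> B
      \<and> (\<lambda>v. lam k * m k v) integrable_on {s..t}"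
    unfolding B_def using assms mean_size_pos[of k] by (intro int mean_size_continuous) (auto intro: less_imp_le)
  have "((\<lambda>v. lam k * (\<phi> k v - m k v)) has_integral (m k t - m k s)) {s..t}"
    using assms by (intro fundamental_theorem_of_calculus)
      (auto simp: has_real_derivative_iff_has_vector_derivative[symmetric] intro!: DERIV_subset[OF mean_size_deriv[of _ t]])
  then have "integral {s..t} (\<lambda>v. lam k * \<phi> k v - lam k * m k v) = m k t - m k s"
    by (simp only: right_diff_distrib integral_unique)
  moreover have "integral {s..t} (\<lambda>v. lam k * \<phi> k v - lam k * m k v) = A - B"
    unfolding A_def B_def using A B by (intro Henstock_Kurzweil_Integration.integral_diff) auto
  ultimately have eq: "m k t + B = m k s + A" by linarith
  have "ennreal (m k t) + ennreal B = ennreal (m k t + B)"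
    using B mean_size_pos[of k t] assms by (intro ennreal_plus[symmetric]) auto
  also have "\<dots> = ennreal (m k s) + ennreal A"
    unfolding eq using A mean_size_pos[of k s] assms by (intro ennreal_plus) auto
  finally show ?thesis using A B by simp
qed

end

section \<open>Summation over the genealogy\<close>

instance branch :: countable
  by countable_datatype

fun root_order :: "branch \<Rightarrow> nat" where
  "root_order (Root k) = k"
| "root_order (Side b i n) = root_order b"
| "root_order (Split b c) = root_order b"

fun generation :: "branch \<Rightarrow> nat" where
  "generation (Root k) = 0"
| "generation (Side b i n) = Suc (generation b)"
| "generation (Split b c) = Suc (generation b)"

text \<open>Orders strictly decrease along a lineage, so a root of order \<open>k\<close> has fewer than \<open>k\<close> generations below it.\<close>
lemma order_add_generation_le: "possible T b \<Longrightarrow> branch_order b + generation b \<le> root_order b"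
  by (induction b) auto

lemma not_occurs: "\<not> possible T b \<Longrightarrow> \<not> occurs T K x b"
  using occurs_imp_possible by blast

text \<open>Unordered sums in \<open>[0, \<infinity>]\<close>, which may be infinite and may be interchanged freely.\<close>
abbreviation sum_all :: "('i \<Rightarrow> ennreal) \<Rightarrow> ennreal" where
  "sum_all f \<equiv> integral\<^sup>N (count_space UNIV) f"

definition offspring_total :: "(branch \<Rightarrow> ennreal) \<Rightarrow> branch \<Rightarrow> ennreal" where
  "offspring_total F b = sum_all (\<lambda>i. \<Sum>n. F (Side b i n)) + F (Split b False) + F (Split b True)"

lemma sum_all_inj:
  fixes F :: "'b \<Rightarrow> ennreal"
  assumes "inj f"
  shows "sum_all (\<lambda>b. F b * indicator (range f) b) = sum_all (\<lambda>x. F (f x))"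
proof -
  have "sum_all (\<lambda>x. F (f x)) = (\<integral>\<^sup>+b. F b \<partial>count_space (range f))"
    using assms by (intro nn_integral_bij_count_space) (simp add: bij_betw_def)
  then show ?thesis
    by (cases "range f = UNIV") (simp_all add: nn_integral_count_space_indicator)
qed

text \<open>Every label is a root or the child of exactly one label.\<close>
lemma sum_all_branch: "sum_all F = (\<Sum>k. F (Root k)) + sum_all (offspring_total F)"
proof -
  let ?side = "\<lambda>(b, i, n). Side b i n" and ?split = "\<lambda>c b. Split b c"
  have split: "sum_all (\<lambda>b. F b * indicator (range (?split c)) b) = sum_all (\<lambda>b. F (Split b c))" for c
    by (subst sum_all_inj) (auto simp: inj_def)
  have "F b = F b * indicator (range Root) b + (F b * indicator (range ?side) b
      + (F b * indicator (range (?split False)) b + F b * indicator (range (?split True)) b))" for b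
    by (cases b) (auto simp: indicator_def image_iff)
  then have "sum_all F = sum_all (\<lambda>b. F b * indicator (range Root) b + (F b * indicator (range ?side) b
      + (F b * indicator (range (?split False)) b + F b * indicator (range (?split True)) b)))"
    by (intro nn_integral_cong) blast
  also have "\<dots> = sum_all (\<lambda>b. F b * indicator (range Root) b) + (sum_all (\<lambda>b. F b * indicator (range ?side) b)
      + (sum_all (\<lambda>b. F b * indicator (range (?split False)) b) + sum_all (\<lambda>b. F b * indicator (range (?split True)) b)))"
    by (simp add: nn_integral_add)
  also have "sum_all (\<lambda>b. F b * indicator (range Root) b) = (\<Sum>k. F (Root k))"
    by (subst sum_all_inj) (auto simp: inj_def nn_integral_count_space_nat)
  also have "sum_all (\<lambda>b. F b * indicator (range ?side) b) = sum_all (\<lambda>(b, i, n). F (Side b i n))"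
    by (subst sum_all_inj) (auto simp: inj_def split_def)
  also have "\<dots> = sum_all (\<lambda>b. sum_all (\<lambda>i. \<Sum>n. F (Side b i n)))"
    by (simp add: nn_integral_fst_count_space[symmetric] nn_integral_count_space_nat)
  also note split
  also note split
  finally show ?thesis
    unfolding offspring_total_def by (simp add: nn_integral_add add.assoc)
qed

context hierarchical_branching_process
begin

sublocale rates: branching_rates T lam
  using T_nonneg lam_pos by unfold_locales

lemma at_birth_cong: "(\<And>t. f t = g t) \<Longrightarrow> at_birth b f = at_birth b g"
  by (rule arg_cong[where f="at_birth b"]) (rule ext)

lemma at_birth_add:
  assumes [measurable]: "f \<in> borel_measurable borel" "g \<in> borel_measurable borel"
  shows "at_birth b (\<lambda>t. f t + g t) = at_birth b f + at_birth b g"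
proof (cases "possible T b")
  case True
  note [measurable] = random_variable_birth_occ[OF True]
  have "at_birth b (\<lambda>t. f t + g t)
      = (\<integral>\<^sup>+\<omega>. (if occ b \<omega> then f (birth b \<omega>) else 0) + (if occ b \<omega> then g (birth b \<omega>) else 0) \<partial>M)"
    unfolding at_birth_def by (intro nn_integral_cong) auto
  also have "\<dots> = at_birth b f + at_birth b g"
    unfolding at_birth_def by (rule nn_integral_add) measurable
  finally show ?thesis .
qed (simp add: at_birth_impossible)

lemma at_birth_finite_sum:
  assumes "\<And>i. i \<in> I \<Longrightarrow> f i \<in> borel_measurable borel"
  shows "at_birth b (\<lambda>t. \<Sum>i\<in>I. f i t) = (\<Sum>i\<in>I. at_birth b (f i))"
  using assms
proof (induction I rule: infinite_finite_induct)
  case (insert i I)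
  then show ?case by (simp add: at_birth_add)
qed (simp_all add: at_birth_def cong: if_cong)

text \<open>The probability that a branch of order \<open>j\<close> born at time \<open>t\<close> is alive at time \<open>s\<close>.\<close>
definition survival :: "real \<Rightarrow> nat \<Rightarrow> real \<Rightarrow> ennreal" where
  "survival s j t = (if t \<le> s then ennreal (exp (- lam j * (s - t))) else 0)"

text \<open>
  The solution \<open>m\<close> of the system read backward from the observation time \<open>s\<close>; in the end it is the mean
  number of branches alive at \<open>s\<close> among a branch of order \<open>j\<close> born at \<open>t\<close> and its descendants.
\<close>
definition progeny :: "real \<Rightarrow> nat \<Rightarrow> real \<Rightarrow> ennreal" where
  "progeny s j t = (if t \<le> s then ennreal (rates.m j (s - t)) else 0)"

lemma survival_measurable [measurable]: "survival s j \<in> borel_measurable borel"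
  unfolding survival_def by measurable

lemma progeny_measurable [measurable]:
  assumes "1 \<le> j"
  shows "progeny s j \<in> borel_measurable borel"
proof -
  have "continuous_on UNIV (\<lambda>t. rates.m j (max 0 (s - t)))"
    by (rule continuous_on_compose2[OF rates.mean_size_continuous[OF assms]]) (auto intro!: continuous_intros)
  then have [measurable]: "(\<lambda>t. rates.m j (max 0 (s - t))) \<in> borel_measurable borel"
    by (rule borel_measurable_continuous_onI)
  have "progeny s j = (\<lambda>t. if t \<le> s then ennreal (rates.m j (max 0 (s - t))) else 0)"
    by (auto simp: progeny_def fun_eq_iff)
  then show ?thesis by simp
qed

lemma progeny_renewal:
  assumes "1 \<le> j"
  shows "progeny s j t = survival s j t
    + (\<Sum>i\<in>{1..<j}. ennreal (gain T (j - i)) * exp_step (lam j) (progeny s i) t)"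
proof (cases "t \<le> s")
  case False
  then have "exp_step (lam j) (progeny s i) t = 0" for i
    unfolding exp_step_def progeny_def
    by (intro nn_integral_zero') (auto simp: exponential_density_def)
  then show ?thesis using False by (simp add: progeny_def survival_def)
next
  case True
  let ?r = "s - t"
  have gain: "0 \<le> gain T (j - i)" if "i \<in> {1..<j}" for i
    using gain_nonneg[of T "j - i"] T_nonneg that by auto
  have m: "0 \<le> rates.m i v" if "0 \<le> v" "1 \<le> i" for i v
    using rates.mean_size_pos[OF that(2,1)] by simp
  have "(\<Sum>i\<in>{1..<j}. ennreal (gain T (j - i)) * exp_step (lam j) (progeny s i) t)
      = (\<Sum>i\<in>{1..<j}. \<integral>\<^sup>+u. ennreal (gain T (j - i)) * (ennreal (exponential_density (lam j) u) * progeny s i (t + u)) \<partial>lborel)"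
    unfolding exp_step_def by (intro sum.cong refl nn_integral_cmult[symmetric]) simp
  also have "\<dots> = (\<integral>\<^sup>+u. (\<Sum>i\<in>{1..<j}. ennreal (gain T (j - i)) * (ennreal (exponential_density (lam j) u) * progeny s i (t + u))) \<partial>lborel)"
    by (intro nn_integral_sum[symmetric]) simp
  also have "\<dots> = (\<integral>\<^sup>+u. ennreal (lam j * exp (- lam j * u) * rates.\<phi> j (?r - u)) * indicator {0..?r} u \<partial>lborel)"
  proof (rule nn_integral_cong)
    fix u
    show "(\<Sum>i\<in>{1..<j}. ennreal (gain T (j - i)) * (ennreal (exponential_density (lam j) u) * progeny s i (t + u)))
        = ennreal (lam j * exp (- lam j * u) * rates.\<phi> j (?r - u)) * indicator {0..?r} u"
    proof (cases "u \<in> {0..?r}")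
      case True
      have l: "0 < lam j" using lam_pos assms by simp
      have "(\<Sum>i\<in>{1..<j}. ennreal (gain T (j - i)) * (ennreal (exponential_density (lam j) u) * progeny s i (t + u)))
          = (\<Sum>i\<in>{1..<j}. ennreal (lam j * exp (- lam j * u) * (gain T (j - i) * rates.m i (?r - u))))"
      proof (rule sum.cong)
        fix i assume i: "i \<in> {1..<j}"
        have "ennreal (gain T (j - i)) * (ennreal (lam j * exp (- lam j * u)) * ennreal (rates.m i (?r - u)))
            = ennreal (lam j * exp (- lam j * u) * (gain T (j - i) * rates.m i (?r - u)))"
          using gain[OF i] m[of "?r - u" i] i l True by (simp add: ennreal_mult[symmetric] mult_ac)
        then show "ennreal (gain T (j - i)) * (ennreal (exponential_density (lam j) u) * progeny s i (t + u))
            = ennreal (lam j * exp (- lam j * u) * (gain T (j - i) * rates.m i (?r - u)))"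
          using True by (simp add: exponential_density_def progeny_def algebra_simps)
      qed simp
      also have "\<dots> = ennreal (\<Sum>i\<in>{1..<j}. lam j * exp (- lam j * u) * (gain T (j - i) * rates.m i (?r - u)))"
        using gain m l True by (intro sum_ennreal) auto
      finally show ?thesis
        using True by (simp add: offspring_size_def sum_distrib_left)
    qed (auto simp: exponential_density_def progeny_def intro!: sum.neutral)
  qed
  finally show ?thesis
    using rates.mean_size_renewal[of ?r j] True assms by (simp add: progeny_def survival_def)
qed

lemma at_birth_zero: "at_birth b (\<lambda>t. 0) = 0"
  by (simp add: at_birth_def)

text \<open>
  Side branches and the split share the waiting law \<open>exp_step\<close>, which is why their contributions merge
  into the single coefficient \<open>gain\<close>.
\<close>
lemma offspring_total_progeny:
  assumes b: "possible T b"
  shows "offspring_total (\<lambda>d. at_birth d (progeny s (branch_order d))) b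
    = at_birth b (\<lambda>t. \<Sum>i\<in>{1..<branch_order b}. ennreal (gain T (branch_order b - i))
        * exp_step (lam (branch_order b)) (progeny s i) t)"
proof -
  let ?j = "branch_order b"
  let ?e = "\<lambda>i. exp_step (lam ?j) (progeny s i)"
  let ?two = "\<lambda>i. ennreal (if ?j - i = 1 then 2 else 0)"
  have side: "sum_all (\<lambda>i. \<Sum>n. at_birth (Side b i n) (progeny s i)) = (\<Sum>i\<in>{1..<?j}. at_birth b (\<lambda>t. ennreal (T (?j - i)) * ?e i t))"
  proof -
    have "sum_all (\<lambda>i. \<Sum>n. at_birth (Side b i n) (progeny s i)) = (\<Sum>i\<in>{1..<?j}. \<Sum>n. at_birth (Side b i n) (progeny s i))"
      by (intro nn_integral_count_space') (auto simp: at_birth_impossible)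
    also have "\<dots> = (\<Sum>i\<in>{1..<?j}. at_birth b (\<lambda>t. ennreal (T (?j - i)) * ?e i t))"
      by (intro sum.cong at_birth_sum_Side) auto
    finally show ?thesis .
  qed
  have split: "at_birth (Split b False) (progeny s (?j - 1)) + at_birth (Split b True) (progeny s (?j - 1))
      = (\<Sum>i\<in>{1..<?j}. at_birth b (\<lambda>t. ?two i * ?e i t))"
  proof (cases "2 \<le> ?j")
    case True
    define k where "k = ?j - 1"
    have k: "1 \<le> k" "?j = Suc k" using True by (auto simp: k_def)
    have [measurable]: "?e k \<in> borel_measurable borel"
      using k(1) by measurable
    have two: "?two k = 2" and "\<And>i. i \<in> {1..<?j} - {k} \<Longrightarrow> ?two i = 0"
      unfolding k(2) by auto
    then have "at_birth b (\<lambda>t. ?two i * ?e i t) = 0" if "i \<in> {1..<?j} - {k}" for i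
      using that by (simp only: mult_zero_left at_birth_zero)
    then have "(\<Sum>i\<in>{1..<?j}. at_birth b (\<lambda>t. ?two i * ?e i t)) = (\<Sum>i\<in>{k}. at_birth b (\<lambda>t. ?two i * ?e i t))"
      using k by (intro sum.mono_neutral_right) auto
    also have "\<dots> = at_birth b (\<lambda>t. ?e k t + ?e k t)"
      by (simp only: sum.insert sum.empty finite.emptyI empty_iff not_False_eq_True add_0_right two mult_2)
    also have "\<dots> = at_birth b (?e k) + at_birth b (?e k)"
      by (rule at_birth_add) measurable
    finally have *: "(\<Sum>i\<in>{1..<?j}. at_birth b (\<lambda>t. ?two i * ?e i t)) = at_birth b (?e k) + at_birth b (?e k)" .
    have "possible T (Split b c)" for c using True b by simp
    from at_birth_Split[OF this progeny_measurable[OF k(1)]]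
    have "at_birth (Split b c) (progeny s (?j - 1)) = at_birth b (?e k)" for c
      unfolding k_def .
    note split = this
    show ?thesis unfolding * split ..
  qed (simp add: at_birth_impossible)
  have "ennreal (gain T (?j - i)) * x = ennreal (T (?j - i)) * x + ?two i * x" if "i \<in> {1..<?j}" for i x
  proof -
    have "ennreal (gain T (?j - i)) = ennreal (T (?j - i)) + ?two i"
      unfolding gain_def using T_nonneg[of "?j - i"] that by (intro ennreal_plus) auto
    then show ?thesis by (simp add: distrib_right)
  qed
  note gain_split = this
  have meas: "(\<lambda>t. c * ?e i t) \<in> borel_measurable borel" if "i \<in> {1..<?j}" for i and c :: ennreal
    using that by (intro borel_measurable_times_ennreal borel_measurable_const exp_step_measurable progeny_measurable) simp
  have "at_birth b (\<lambda>t. \<Sum>i\<in>{1..<?j}. ennreal (gain T (?j - i)) * ?e i t)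
      = at_birth b (\<lambda>t. (\<Sum>i\<in>{1..<?j}. ennreal (T (?j - i)) * ?e i t) + (\<Sum>i\<in>{1..<?j}. ?two i * ?e i t))"
    by (rule at_birth_cong) (simp only: sum.distrib[symmetric] gain_split cong: sum.cong)
  also have "\<dots> = at_birth b (\<lambda>t. \<Sum>i\<in>{1..<?j}. ennreal (T (?j - i)) * ?e i t)
      + at_birth b (\<lambda>t. \<Sum>i\<in>{1..<?j}. ?two i * ?e i t)"
    by (intro at_birth_add borel_measurable_sum meas)
  also have "at_birth b (\<lambda>t. \<Sum>i\<in>{1..<?j}. ennreal (T (?j - i)) * ?e i t)
      = (\<Sum>i\<in>{1..<?j}. at_birth b (\<lambda>t. ennreal (T (?j - i)) * ?e i t))"
    by (rule at_birth_finite_sum[OF meas])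
  also have "at_birth b (\<lambda>t. \<Sum>i\<in>{1..<?j}. ?two i * ?e i t) = (\<Sum>i\<in>{1..<?j}. at_birth b (\<lambda>t. ?two i * ?e i t))"
    by (rule at_birth_finite_sum[OF meas])
  finally show ?thesis
    unfolding side[symmetric] split[symmetric] by (simp only: offspring_total_def branch_order.simps add.assoc)
qed

text \<open>
  The progeny of a branch is the branch itself plus the progenies of its children. Both sides vanish
  if \<open>b\<close> is not a possible label.
\<close>
lemma progeny_balance:
  "at_birth b (progeny s (branch_order b)) = at_birth b (survival s (branch_order b))
    + offspring_total (\<lambda>d. at_birth d (progeny s (branch_order d))) b"
proof (cases "possible T b")
  case True
  have j: "1 \<le> branch_order b" by (rule order_pos[OF True])
  have "at_birth b (progeny s (branch_order b)) = at_birth b (\<lambda>t. survival s (branch_order b) t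
      + (\<Sum>i\<in>{1..<branch_order b}. ennreal (gain T (branch_order b - i))
        * exp_step (lam (branch_order b)) (progeny s i) t))"
    by (rule at_birth_cong) (rule progeny_renewal[OF j])
  also have "\<dots> = at_birth b (survival s (branch_order b)) + at_birth b (\<lambda>t.
      \<Sum>i\<in>{1..<branch_order b}. ennreal (gain T (branch_order b - i))
        * exp_step (lam (branch_order b)) (progeny s i) t)"
    by (rule at_birth_add) auto
  finally show ?thesis unfolding offspring_total_progeny[OF True] .
next
  case False
  then have "at_birth (Side b i n) f = 0" "at_birth (Split b c) f = 0" for i n c f
    by (auto intro: at_birth_impossible)
  with False show ?thesis by (simp add: at_birth_impossible offspring_total_def)
qed

definition generation_total :: "nat \<Rightarrow> nat \<Rightarrow> (branch \<Rightarrow> ennreal) \<Rightarrow> ennreal" where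
  "generation_total k n F = sum_all (\<lambda>b. if root_order b = k \<and> generation b = n then F b else 0)"

lemma generation_total_add:
  "generation_total k n (\<lambda>b. F b + G b) = generation_total k n F + generation_total k n G"
  unfolding generation_total_def by (subst nn_integral_add[symmetric]) (auto intro!: nn_integral_cong)

lemma generation_total_0: "generation_total k 0 F = F (Root k)"
proof -
  let ?F = "\<lambda>b. if root_order b = k \<and> generation b = 0 then F b else 0"
  have "generation_total k 0 F = (\<Sum>i. ?F (Root i)) + sum_all (offspring_total ?F)"
    unfolding generation_total_def by (rule sum_all_branch)
  also have "sum_all (offspring_total ?F) = 0"
    by (simp add: offspring_total_def[abs_def])
  also have "(\<Sum>i. ?F (Root i)) = F (Root k)"
    by (subst suminf_finite[of "{k}"]) auto
  finally show ?thesis by simp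
qed

lemma generation_total_Suc: "generation_total k (Suc n) F = generation_total k n (offspring_total F)"
proof -
  let ?F = "\<lambda>b. if root_order b = k \<and> generation b = Suc n then F b else 0"
  have "generation_total k (Suc n) F = (\<Sum>i. ?F (Root i)) + sum_all (offspring_total ?F)"
    unfolding generation_total_def by (rule sum_all_branch)
  also have "\<dots> = sum_all (offspring_total ?F)" by simp
  also have "\<dots> = generation_total k n (offspring_total F)"
    unfolding generation_total_def by (intro nn_integral_cong) (auto simp: offspring_total_def)
  finally show ?thesis .
qed

lemma generation_total_extinct:
  assumes "k \<le> n"
  shows "generation_total k n (\<lambda>b. at_birth b (f b)) = 0"
proof -
  have "(if root_order b = k \<and> generation b = n then at_birth b (f b) else 0) = 0" for b
    using order_add_generation_le[of T b] order_pos[of T b] assms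
    by (cases "possible T b") (auto simp: at_birth_impossible)
  then show ?thesis by (simp add: generation_total_def)
qed

text \<open>
  Telescoping \<open>progeny_balance\<close> over the generations. The remainder after \<open>N\<close> generations is zero for
  \<open>N \<ge> k\<close> because a root of order \<open>k\<close> has no descendants that deep.
\<close>
lemma total_survival_root:
  "(\<Sum>n. generation_total k n (\<lambda>b. at_birth b (survival s (branch_order b)))) = at_birth (Root k) (progeny s k)"
proof -
  let ?G = "\<lambda>b. at_birth b (survival s (branch_order b))"
  let ?H = "\<lambda>b. at_birth b (progeny s (branch_order b))"
  have step: "generation_total k n ?H = generation_total k n ?G + generation_total k (Suc n) ?H" for n
  proof -
    have "generation_total k n ?H = generation_total k n (\<lambda>b. ?G b + offspring_total ?H b)"
      by (rule arg_cong[where f="generation_total k n"]) (rule ext, rule progeny_balance)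
    then show ?thesis by (simp only: generation_total_add generation_total_Suc)
  qed
  have "generation_total k 0 ?H = (\<Sum>n<N. generation_total k n ?G) + generation_total k N ?H" for N
  proof (induction N)
    case (Suc N)
    then show ?case by (simp add: step[of N] add.assoc)
  qed simp
  from this[of k] have "at_birth (Root k) (progeny s k) = (\<Sum>n<k. generation_total k n ?G)"
    by (simp add: generation_total_0 generation_total_extinct)
  also have "\<dots> = (\<Sum>n. generation_total k n ?G)"
    by (intro suminf_finite[symmetric]) (auto simp: generation_total_extinct)
  finally show ?thesis by simp
qed

lemma sum_all_by_generation: "sum_all F = (\<Sum>k. \<Sum>n. generation_total k n F)"
proof -
  have "F b = (\<Sum>k. \<Sum>n. if root_order b = k \<and> generation b = n then F b else 0)" for b
  proof -
    have "(\<Sum>n. if root_order b = k \<and> generation b = n then F b else 0) = (if root_order b = k then F b else 0)" for k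
      by (subst suminf_finite[of "{generation b}"]) auto
    moreover have "(\<Sum>k. if root_order b = k then F b else 0) = F b"
      by (subst suminf_finite[of "{root_order b}"]) auto
    ultimately show ?thesis by simp
  qed
  then have "sum_all F = sum_all (\<lambda>b. \<Sum>k. \<Sum>n. if root_order b = k \<and> generation b = n then F b else 0)"
    by (rule nn_integral_cong)
  also have "\<dots> = (\<Sum>k. \<Sum>n. generation_total k n F)"
    unfolding generation_total_def by (simp add: nn_integral_suminf)
  finally show ?thesis .
qed

text \<open>Linearity of expectation; each label contributes its probability of being alive, see \<open>mean_alive\<close>.\<close>
lemma width_function_total:
  "width_function M T K X s = sum_all (\<lambda>b. at_birth b (survival s (branch_order b)))"
proof -
  let ?A = "\<lambda>b \<omega>. if alive_at T (K \<omega>) (\<lambda>c. X c \<omega>) s b then 1 else 0 :: ennreal"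
  have A: "?A b \<in> borel_measurable M" for b
  proof (cases "possible T b")
    case True
    have [measurable]: "random_variable borel (X (Life b))"
      using clock_exponential[of "Life b"] True by (auto simp: clocks_def distributed_def)
    note [measurable] = random_variable_birth_occ[OF True]
    show ?thesis unfolding alive_at_def by measurable
  next
    case False
    then show ?thesis by (simp add: alive_at_def not_occurs)
  qed
  have count: "branch_count T (K \<omega>) (\<lambda>c. X c \<omega>) (Suc j) s = sum_all (\<lambda>b. if branch_order b = Suc j then ?A b \<omega> else 0)" for \<omega> j
  proof -
    have "branch_count T (K \<omega>) (\<lambda>c. X c \<omega>) (Suc j) s
        = sum_all (indicator {b. branch_order b = Suc j \<and> alive_at T (K \<omega>) (\<lambda>c. X c \<omega>) s b})"
      unfolding branch_count_def by simp
    also have "\<dots> = sum_all (\<lambda>b. if branch_order b = Suc j then ?A b \<omega> else 0)"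
      by (intro nn_integral_cong) (auto simp: indicator_def)
    finally show ?thesis .
  qed
  have "width_function M T K X s = (\<Sum>j. sum_all (\<lambda>b. \<integral>\<^sup>+\<omega>. (if branch_order b = Suc j then ?A b \<omega> else 0) \<partial>M))"
    unfolding width_function_def mean_count_def count
    using A by (subst nn_integral_count_space_nn_integral) auto
  also have "\<dots> = sum_all (\<lambda>b. \<Sum>j. \<integral>\<^sup>+\<omega>. (if branch_order b = Suc j then ?A b \<omega> else 0) \<partial>M)"
    by (simp add: nn_integral_suminf)
  also have "\<dots> = sum_all (\<lambda>b. at_birth b (survival s (branch_order b)))"
  proof (rule nn_integral_cong)
    fix b
    show "(\<Sum>j. \<integral>\<^sup>+\<omega>. (if branch_order b = Suc j then ?A b \<omega> else 0) \<partial>M) = at_birth b (survival s (branch_order b))"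
    proof (cases "possible T b")
      case True
      then obtain j where j: "branch_order b = Suc j"
        using order_pos[OF True] by (cases "branch_order b") auto
      have "(\<Sum>j. \<integral>\<^sup>+\<omega>. (if branch_order b = Suc j then ?A b \<omega> else 0) \<partial>M)
          = (\<Sum>j\<in>{j}. \<integral>\<^sup>+\<omega>. (if branch_order b = Suc j then ?A b \<omega> else 0) \<partial>M)"
        by (rule suminf_finite) (auto simp: j)
      also have "\<dots> = (\<integral>\<^sup>+\<omega>. ?A b \<omega> \<partial>M)" by (simp add: j)
      finally show ?thesis unfolding mean_alive[OF True] survival_def by simp
    next
      case False
      then have "\<not> alive_at T (K \<omega>) (\<lambda>c. X c \<omega>) s b" for \<omega>
        by (simp add: alive_at_def not_occurs)
      then have "?A b \<omega> = 0" for \<omega> by simp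
      then show ?thesis
        by (simp only: at_birth_impossible[OF False] if_cancel nn_integral_const mult_zero_left suminf_zero)
    qed
  qed
  finally show ?thesis .
qed

text \<open>The width function is the average over the root order of the solutions of the triangular system.\<close>
theorem width_function_eq:
  assumes "0 \<le> s"
  shows "width_function M T K X s = (\<Sum>k. ennreal (pr (Suc k) * mean_size T lam (Suc k) s))"
proof -
  have "width_function M T K X s = (\<Sum>k. at_birth (Root k) (progeny s k))"
    unfolding width_function_total sum_all_by_generation total_survival_root ..
  also have "\<dots> = (\<Sum>k. at_birth (Root (k + 1)) (progeny s (k + 1))) + (\<Sum>k<1. at_birth (Root k) (progeny s k))"
    by (rule suminf_offset) simp
  also have "\<dots> = (\<Sum>k. ennreal (pr (Suc k) * mean_size T lam (Suc k) s))"
    using assms pr_nonneg rates.mean_size_pos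
    by (simp add: at_birth_impossible at_birth_Root progeny_def ennreal_mult less_imp_le)
  finally show ?thesis .
qed

end

section \<open>Generating functions of geometrically weighted means\<close>

text \<open>A partial sum of a Cauchy product covers only a triangle of the square of all products.\<close>
lemma sum_triangle_le_product:
  fixes f g :: "nat \<Rightarrow> real"
  assumes "\<And>i. 0 \<le> f i" "\<And>i. 0 \<le> g i"
  shows "(\<Sum>k<n. \<Sum>i\<le>k. f i * g (k - i)) \<le> (\<Sum>i<n. f i) * (\<Sum>j<n. g j)"
proof -
  have "(\<Sum>k<n. \<Sum>i\<le>k. f i * g (k - i)) = (\<Sum>(i, j)\<in>{(i, j). i + j < n}. f i * g j)"
    by (rule sum.triangle_reindex[symmetric])
  also have "\<dots> \<le> (\<Sum>(i, j)\<in>{..<n} \<times> {..<n}. f i * g j)"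
    using assms by (intro sum_mono2) auto
  also have "\<dots> = (\<Sum>i<n. f i) * (\<Sum>j<n. g j)"
    by (simp add: sum_product sum.cartesian_product)
  finally show ?thesis .
qed

text \<open>
  \<open>a\<close> is the ratio of the geometric root law. The summability assumption places \<open>a / \<zeta>\<close> in the domain of
  \<open>t_hat\<close>; the number \<open>a\<close> itself may lie outside, and it is the decay of the rates that gains the factor
  \<open>1 / \<zeta>\<close>.
\<close>
locale self_similar_rates =
  fixes T :: "nat \<Rightarrow> real" and \<gamma> \<zeta> a :: real
  assumes coeff_nonneg: "1 \<le> k \<Longrightarrow> 0 \<le> T k"
    and rate: "0 < \<gamma>" "1 \<le> \<zeta>" and weight: "0 < a" "a < 1"
    and gain_summable: "summable (\<lambda>k. gain T (Suc k) * (a / \<zeta>) ^ Suc k)"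
begin

sublocale branching_rates T "\<lambda>j. \<gamma> * \<zeta> powi (- int j)"
  using coeff_nonneg rate by unfold_locales auto

definition scaled_weight :: real where "scaled_weight = a / \<zeta>"

text \<open>In terms of the Tokunaga series, this is \<open>1 + t_hat T (a / \<zeta>)\<close>.\<close>
definition total_gain :: real where "total_gain = (\<Sum>k. gain T (Suc k) * scaled_weight ^ Suc k)"

definition weighted_size :: "real \<Rightarrow> real \<Rightarrow> real" where
  "weighted_size z s = (\<Sum>k. z ^ Suc k * m (Suc k) s)"

lemma scaled_weight: "0 < scaled_weight" "scaled_weight \<le> a"
  using rate weight by (auto simp: scaled_weight_def field_simps)

lemma rate_weight: "a ^ k * (\<gamma> * \<zeta> powi (- int k)) = \<gamma> * scaled_weight ^ k"
  by (simp add: scaled_weight_def power_int_minus power_divide field_simps)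

lemma weighted_gain_nonneg: "0 \<le> gain T (Suc k) * scaled_weight ^ Suc k"
  using gain_nonneg[of T "Suc k", OF coeff_nonneg] scaled_weight by simp

lemma total_gain: "(\<lambda>k. gain T (Suc k) * scaled_weight ^ Suc k) sums total_gain" "0 \<le> total_gain"
  using gain_summable weighted_gain_nonneg unfolding total_gain_def scaled_weight_def
  by (auto intro: summable_sums suminf_nonneg)

lemma offspring_size_1: "\<phi> (Suc 0) s = 0"
  by (simp add: offspring_size_def)

text \<open>
  The Toeplitz structure: with weights that are powers of one number, \<open>\<phi>\<close> is the convolution of the
  weighted means with the weighted gains. Indices are shifted by one on both factors since orders start
  at 1, hence by two on the left.
\<close>
lemma offspring_size_convolution:
  "scaled_weight ^ Suc (Suc k) * \<phi> (Suc (Suc k)) s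
    = (\<Sum>i\<le>k. (scaled_weight ^ Suc i * m (Suc i) s) * (gain T (Suc (k - i)) * scaled_weight ^ Suc (k - i)))"
proof -
  have "\<phi> (Suc (Suc k)) s = (\<Sum>i\<le>k. gain T (Suc k - i) * m (Suc i) s)"
  proof -
    have "{1..<Suc (Suc k)} = Suc ` {..k}"
      by (simp add: image_Suc_atMost atLeastLessThanSuc_atLeastAtMost)
    then show ?thesis unfolding offspring_size_def by (simp add: sum.reindex)
  qed
  also have "scaled_weight ^ Suc (Suc k) * \<dots>
      = (\<Sum>i\<le>k. (scaled_weight ^ Suc i * m (Suc i) s) * (gain T (Suc (k - i)) * scaled_weight ^ Suc (k - i)))"
    unfolding sum_distrib_left
  proof (rule sum.cong)
    fix i assume "i \<in> {..k}"
    then have "Suc (Suc k) = Suc i + Suc (k - i)" "Suc k - i = Suc (k - i)" by auto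
    then show "scaled_weight ^ Suc (Suc k) * (gain T (Suc k - i) * m (Suc i) s)
        = (scaled_weight ^ Suc i * m (Suc i) s) * (gain T (Suc (k - i)) * scaled_weight ^ Suc (k - i))"
      by (simp only: power_add mult_ac)
  qed simp
  finally show ?thesis .
qed

lemma partial_offspring_le:
  assumes "0 \<le> s"
  shows "(\<Sum>k<n. scaled_weight ^ Suc k * \<phi> (Suc k) s) \<le> total_gain * (\<Sum>k<n. scaled_weight ^ Suc k * m (Suc k) s)"
proof (cases n)
  case (Suc n')
  have nonneg: "0 \<le> scaled_weight ^ Suc i * m (Suc i) s" for i
    using scaled_weight mean_size_pos[of "Suc i" s] assms by simp
  have "(\<Sum>k<n. scaled_weight ^ Suc k * \<phi> (Suc k) s) = (\<Sum>k<n'. scaled_weight ^ Suc (Suc k) * \<phi> (Suc (Suc k)) s)"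
    by (simp only: Suc sum.lessThan_Suc_shift offspring_size_1 mult_zero_right add_0_left)
  also have "\<dots> \<le> (\<Sum>k<n'. scaled_weight ^ Suc k * m (Suc k) s) * (\<Sum>k<n'. gain T (Suc k) * scaled_weight ^ Suc k)"
    unfolding offspring_size_convolution
    by (rule sum_triangle_le_product[OF nonneg weighted_gain_nonneg])
  also have "\<dots> \<le> (\<Sum>k<n. scaled_weight ^ Suc k * m (Suc k) s) * total_gain"
  proof (rule mult_mono)
    show "(\<Sum>k<n'. scaled_weight ^ Suc k * m (Suc k) s) \<le> (\<Sum>k<n. scaled_weight ^ Suc k * m (Suc k) s)"
      using nonneg[of n'] by (simp add: Suc)
    show "(\<Sum>k<n'. gain T (Suc k) * scaled_weight ^ Suc k) \<le> total_gain"
      using sum_le_suminf[OF sums_summable[OF total_gain(1)], of "{..<n'}"] weighted_gain_nonneg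
      by (simp add: total_gain_def)
  qed (use nonneg weighted_gain_nonneg in \<open>auto intro!: sum_nonneg simp del: power_Suc\<close>)
  finally show ?thesis by (simp add: mult.commute)
qed simp

text \<open>
  Gronwall's inequality for the partial sums, with a constant that does not depend on their length. It
  closes because weighting by \<open>a\<^sup>k\<close> and multiplying by the rate leaves the smaller weight
  \<open>(a / \<zeta>)\<^sup>k \<le> a\<^sup>k\<close>.
\<close>
lemma partial_weighted_size_le:
  assumes s: "0 \<le> s"
  shows "(\<Sum>k<n. a ^ Suc k * m (Suc k) s) \<le> (\<Sum>k<n. a ^ Suc k) * exp (\<gamma> * total_gain * s)"
proof -
  define G where "G s = (\<Sum>k<n. a ^ Suc k * m (Suc k) s)" for s
  define G' where "G' s = (\<Sum>k<n. a ^ Suc k * ((\<gamma> * \<zeta> powi (- int (Suc k))) * (\<phi> (Suc k) s - m (Suc k) s)))" for s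
  let ?r = "\<gamma> * total_gain"
  have deriv: "(G has_real_derivative G' x) (at x within {0..s})" if "x \<in> {0..s}" for x
    unfolding G_def[abs_def] G'_def using that by (intro DERIV_sum DERIV_cmult mean_size_deriv) auto
  have le: "G' x \<le> ?r * G x" if "0 \<le> x" for x
  proof -
    have nonneg: "0 \<le> m (Suc k) x" for k
      using mean_size_pos[of "Suc k" x] that by simp
    have "G' x = (\<Sum>k<n. \<gamma> * scaled_weight ^ Suc k * (\<phi> (Suc k) x - m (Suc k) x))"
      unfolding G'_def by (simp only: mult.assoc[symmetric] rate_weight[unfolded mult.assoc[symmetric]])
    also have "\<dots> \<le> (\<Sum>k<n. \<gamma> * (scaled_weight ^ Suc k * \<phi> (Suc k) x))"
      using nonneg scaled_weight rate by (intro sum_mono) (simp add: mult.assoc)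
    also have "\<dots> = \<gamma> * (\<Sum>k<n. scaled_weight ^ Suc k * \<phi> (Suc k) x)"
      by (simp only: sum_distrib_left)
    also have "\<dots> \<le> \<gamma> * (total_gain * (\<Sum>k<n. scaled_weight ^ Suc k * m (Suc k) x))"
      using partial_offspring_le[OF that] rate by (intro mult_left_mono) auto
    also have "(\<Sum>k<n. scaled_weight ^ Suc k * m (Suc k) x) \<le> G x"
      unfolding G_def using nonneg scaled_weight by (intro sum_mono mult_right_mono power_mono) auto
    finally show ?thesis
      using rate total_gain(2) by (simp add: mult.assoc mult_left_mono)
  qed
  \<comment> \<open>Dividing by the exponential bound leaves a nonincreasing function.\<close>
  define D where "D x = G x * exp (- ?r * x)" for x
  have D: "(D has_real_derivative (G' x - ?r * G x) * exp (- ?r * x)) (at x within {0..s})" if "x \<in> {0..s}" for x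
  proof -
    have "((\<lambda>x. exp (- ?r * x)) has_real_derivative - ?r * exp (- ?r * x)) (at x within {0..s})"
      by (auto intro!: derivative_eq_intros)
    from DERIV_mult[OF deriv[OF that] this] show ?thesis
      unfolding D_def[abs_def] by (simp add: algebra_simps)
  qed
  have "D s \<le> D 0"
  proof (rule DERIV_nonpos_imp_decreasing_open[OF s])
    fix x assume x: "0 < x" "x < s"
    then have "(D has_real_derivative (G' x - ?r * G x) * exp (- ?r * x)) (at x)"
      using D[of x] by (simp add: at_within_Icc_at)
    moreover have "(G' x - ?r * G x) * exp (- ?r * x) \<le> 0"
      using le[of x] x by (simp add: mult_nonpos_nonneg)
    ultimately show "\<exists>y. (D has_real_derivative y) (at x) \<and> y \<le> 0" by blast
  next
    show "continuous_on {0..s} D"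
      by (rule DERIV_continuous_on[OF D])
  qed
  then have "G s * exp (- ?r * s) \<le> G 0" by (simp add: D_def)
  then have "G s * exp (- ?r * s) * exp (?r * s) \<le> G 0 * exp (?r * s)"
    by (intro mult_right_mono) auto
  moreover have "exp (- ?r * s) * exp (?r * s) = 1" by (simp add: exp_add[symmetric])
  ultimately have "G s \<le> G 0 * exp (?r * s)" by (simp only: mult.assoc mult_1_right)
  then show ?thesis by (simp add: G_def)
qed

lemma weighted_size_sums:
  assumes s: "0 \<le> s" and z: "0 < z" "z \<le> a"
  shows "(\<lambda>k. z ^ Suc k * m (Suc k) s) sums weighted_size z s"
    and "weighted_size z s \<le> a / (1 - a) * exp (\<gamma> * total_gain * s)"
    and "0 < weighted_size z s"
proof -
  let ?B = "a / (1 - a) * exp (\<gamma> * total_gain * s)"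
  have nonneg: "0 \<le> m (Suc k) s" for k
    using mean_size_pos[of "Suc k" s] s by simp
  have geo: "(\<lambda>k. a ^ Suc k) sums (a / (1 - a))"
    using sums_mult[OF geometric_sums[of a], of a] weight by simp
  have le: "(\<Sum>k<n. z ^ Suc k * m (Suc k) s) \<le> ?B" for n
  proof -
    have "(\<Sum>k<n. z ^ Suc k * m (Suc k) s) \<le> (\<Sum>k<n. a ^ Suc k * m (Suc k) s)"
      using nonneg z by (intro sum_mono mult_right_mono power_mono) auto
    also have "\<dots> \<le> (\<Sum>k<n. a ^ Suc k) * exp (\<gamma> * total_gain * s)"
      by (rule partial_weighted_size_le[OF s])
    also have "\<dots> \<le> ?B"
      using sum_le_suminf[OF sums_summable[OF geo], of "{..<n}"] sums_unique[OF geo] weight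
      by (intro mult_right_mono) auto
    finally show ?thesis .
  qed
  have summable: "summable (\<lambda>k. z ^ Suc k * m (Suc k) s)"
    using nonneg z le by (intro summableI_nonneg_bounded[where x="?B"]) auto
  then show "(\<lambda>k. z ^ Suc k * m (Suc k) s) sums weighted_size z s"
    unfolding weighted_size_def by (rule summable_sums)
  show "weighted_size z s \<le> ?B"
    unfolding weighted_size_def by (rule suminf_le_const[OF summable]) (rule le)
  show "0 < weighted_size z s"
    unfolding weighted_size_def using z mean_size_pos[of "Suc _" s] s
    by (intro suminf_pos[OF summable]) auto
qed

lemma weighted_offspring_sums:
  assumes "0 \<le> s"
  shows "(\<lambda>k. scaled_weight ^ Suc k * \<phi> (Suc k) s) sums (total_gain * weighted_size scaled_weight s)"
proof -
  note F = weighted_size_sums(1)[OF assms scaled_weight]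
  have "0 \<le> m (Suc k) s" for k
    using mean_size_pos[of "Suc k" s] assms by simp
  then have "(\<lambda>k. scaled_weight ^ Suc (Suc k) * \<phi> (Suc (Suc k)) s) sums (weighted_size scaled_weight s * total_gain)"
    unfolding offspring_size_convolution weighted_size_def total_gain_def
    using sums_summable[OF F] sums_summable[OF total_gain(1)] weighted_gain_nonneg scaled_weight
    by (intro Cauchy_product_sums) (simp_all only: real_norm_def abs_of_nonneg zero_le_mult_iff zero_le_power less_imp_le simp_thms)
  then show ?thesis
    using sums_Suc[of "\<lambda>k. scaled_weight ^ Suc k * \<phi> (Suc k) s"] by (simp add: offspring_size_1 mult.commute)
qed

lemma continuous_indicator_measurable:
  fixes h :: "real \<Rightarrow> real"
  assumes "continuous_on {0..} h" "0 \<le> s"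
  shows "(\<lambda>v. ennreal (h v) * indicator {s..t} v) \<in> borel_measurable borel"
proof -
  have "continuous_on {s..t} h"
    using assms by (intro continuous_on_subset[OF assms(1)]) auto
  then have "(\<lambda>v. indicator {s..t} v *\<^sub>R h v) \<in> borel_measurable borel"
    by (intro borel_measurable_continuous_on_indicator) auto
  then have "(\<lambda>v. ennreal (indicator {s..t} v *\<^sub>R h v)) \<in> borel_measurable borel"
    by measurable
  moreover have "ennreal (indicator {s..t} v *\<^sub>R h v) = ennreal (h v) * indicator {s..t} v" for v
    by (auto simp: indicator_def)
  ultimately show ?thesis by simp
qed

lemma mean_size_measurable:
  "0 \<le> s \<Longrightarrow> 1 \<le> k \<Longrightarrow> (\<lambda>v. ennreal (m k v) * indicator {s..t} v) \<in> borel_measurable borel"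
  by (rule continuous_indicator_measurable[OF mean_size_continuous])

lemma offspring_size_measurable:
  "0 \<le> s \<Longrightarrow> (\<lambda>v. ennreal (\<phi> k v) * indicator {s..t} v) \<in> borel_measurable borel"
  by (rule continuous_indicator_measurable[OF offspring_size_continuous])

lemma ennreal_series_mult:
  assumes "\<And>k. 0 \<le> h k" "(\<lambda>k. scaled_weight ^ Suc k * h k) sums H"
  shows "(\<Sum>k. ennreal (scaled_weight ^ Suc k) * (ennreal (h k) * i)) = ennreal H * i"
proof -
  have "(\<Sum>k. ennreal (scaled_weight ^ Suc k) * (ennreal (h k) * i)) = (\<Sum>k. ennreal (scaled_weight ^ Suc k * h k) * i)"
    using assms scaled_weight by (simp add: ennreal_mult mult.assoc del: power_Suc)
  also have "\<dots> = (\<Sum>k. ennreal (scaled_weight ^ Suc k * h k)) * i"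
    by (rule ennreal_suminf_multc)
  also have "(\<Sum>k. ennreal (scaled_weight ^ Suc k * h k)) = ennreal H"
    using assms scaled_weight by (subst suminf_ennreal2) (auto simp: sums_iff simp del: power_Suc)
  finally show ?thesis .
qed

text \<open>
  Summation of the birth and death terms of \<open>mean_size_balance\<close>: the rate of order \<open>k\<close> changes the weight
  \<open>a\<^sup>k\<close> into \<open>\<gamma> (a / \<zeta>)\<^sup>k\<close>, and monotone convergence moves the sum inside the integral.
\<close>
lemma suminf_weighted_integral:
  assumes h: "\<And>k. (\<lambda>v. ennreal (h k v) * indicator {s..t} v) \<in> borel_measurable borel"
    and pos: "\<And>k v. s \<le> v \<Longrightarrow> 0 \<le> h k v"
    and sums: "\<And>v. s \<le> v \<Longrightarrow> (\<lambda>k. scaled_weight ^ Suc k * h k v) sums H v"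
  shows "(\<Sum>k. ennreal (a ^ Suc k) * (\<integral>\<^sup>+v. ennreal ((\<gamma> * \<zeta> powi (- int (Suc k))) * h k v) * indicator {s..t} v \<partial>lborel))
       = ennreal \<gamma> * (\<integral>\<^sup>+v. ennreal (H v) * indicator {s..t} v \<partial>lborel)"
proof -
  have *: "ennreal (a ^ Suc k) * (\<integral>\<^sup>+v. ennreal ((\<gamma> * \<zeta> powi (- int (Suc k))) * h k v) * indicator {s..t} v \<partial>lborel)
      = ennreal \<gamma> * (\<integral>\<^sup>+v. ennreal (scaled_weight ^ Suc k) * (ennreal (h k v) * indicator {s..t} v) \<partial>lborel)" for k
  proof -
    let ?l = "\<gamma> * \<zeta> powi (- int (Suc k))"
    have l: "0 \<le> ?l" using rate by simp
    have "(\<integral>\<^sup>+v. ennreal (?l * h k v) * indicator {s..t} v \<partial>lborel)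
        = (\<integral>\<^sup>+v. ennreal ?l * (ennreal (h k v) * indicator {s..t} v) \<partial>lborel)"
      using l pos by (intro nn_integral_cong) (auto simp: indicator_def ennreal_mult)
    also have "\<dots> = ennreal ?l * (\<integral>\<^sup>+v. ennreal (h k v) * indicator {s..t} v \<partial>lborel)"
      using h by (intro nn_integral_cmult) simp
    finally have "ennreal (a ^ Suc k) * (\<integral>\<^sup>+v. ennreal (?l * h k v) * indicator {s..t} v \<partial>lborel)
        = ennreal (a ^ Suc k * ?l) * (\<integral>\<^sup>+v. ennreal (h k v) * indicator {s..t} v \<partial>lborel)"
      using l weight by (simp only: ennreal_mult zero_le_power less_imp_le mult.assoc)
    also have "\<dots> = ennreal \<gamma> * (ennreal (scaled_weight ^ Suc k) * (\<integral>\<^sup>+v. ennreal (h k v) * indicator {s..t} v \<partial>lborel))"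
      unfolding rate_weight using rate scaled_weight by (simp only: ennreal_mult zero_le_power less_imp_le mult.assoc)
    also have "ennreal (scaled_weight ^ Suc k) * (\<integral>\<^sup>+v. ennreal (h k v) * indicator {s..t} v \<partial>lborel)
        = (\<integral>\<^sup>+v. ennreal (scaled_weight ^ Suc k) * (ennreal (h k v) * indicator {s..t} v) \<partial>lborel)"
      using h by (intro nn_integral_cmult[symmetric]) simp
    finally show ?thesis .
  qed
  have "(\<Sum>k. ennreal (a ^ Suc k) * (\<integral>\<^sup>+v. ennreal ((\<gamma> * \<zeta> powi (- int (Suc k))) * h k v) * indicator {s..t} v \<partial>lborel))
      = ennreal \<gamma> * (\<Sum>k. \<integral>\<^sup>+v. ennreal (scaled_weight ^ Suc k) * (ennreal (h k v) * indicator {s..t} v) \<partial>lborel)"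
    unfolding * by (rule ennreal_suminf_cmult)
  also have "(\<Sum>k. \<integral>\<^sup>+v. ennreal (scaled_weight ^ Suc k) * (ennreal (h k v) * indicator {s..t} v) \<partial>lborel)
      = (\<integral>\<^sup>+v. (\<Sum>k. ennreal (scaled_weight ^ Suc k) * (ennreal (h k v) * indicator {s..t} v)) \<partial>lborel)"
  proof (rule nn_integral_suminf[symmetric])
    show "(\<lambda>v. ennreal (scaled_weight ^ Suc k) * (ennreal (h k v) * indicator {s..t} v)) \<in> borel_measurable lborel" for k
      using borel_measurable_times_ennreal[OF borel_measurable_const[of "ennreal (scaled_weight ^ Suc k)"] h[of k]] by simp
  qed
  also have "\<dots> = (\<integral>\<^sup>+v. ennreal (H v) * indicator {s..t} v \<partial>lborel)"
  proof (rule nn_integral_cong)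
    fix v
    show "(\<Sum>k. ennreal (scaled_weight ^ Suc k) * (ennreal (h k v) * indicator {s..t} v)) = ennreal (H v) * indicator {s..t} v"
    proof (cases "v \<in> {s..t}")
      case True
      then show ?thesis using pos sums by (intro ennreal_series_mult) auto
    qed simp
  qed
  finally show ?thesis .
qed

text \<open>
  The evolution of the generating function, \<open>F\<^sub>a' = \<gamma> (total_gain - 1) F\<^bsub>a/\<zeta>\<^esub>\<close>, integrated from \<open>s\<close> to
  \<open>t\<close>; the witness \<open>J\<close> is the integral of \<open>F\<^bsub>a/\<zeta>\<^esub>\<close>. Its strict positivity makes the monotonicity of
  the width function strict.
\<close>
lemma weighted_size_balance:
  assumes s: "0 \<le> s" "s < t"
  obtains J where "0 < J"
    "weighted_size a t + \<gamma> * J = weighted_size a s + \<gamma> * (total_gain * J)"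
proof -
  let ?J = "\<integral>\<^sup>+v. ennreal (weighted_size scaled_weight v) * indicator {s..t} v \<partial>lborel"
  have sum_a: "(\<Sum>k. ennreal (a ^ Suc k) * ennreal (m (Suc k) r)) = ennreal (weighted_size a r)" if "0 \<le> r" for r
  proof -
    have "ennreal (a ^ Suc k) * ennreal (m (Suc k) r) = ennreal (a ^ Suc k * m (Suc k) r)" for k
      using weight mean_size_pos[of "Suc k" r] that by (intro ennreal_mult[symmetric]) auto
    then show ?thesis
      using weighted_size_sums(1)[OF that weight(1) order_refl] weight mean_size_pos[of "Suc _" r] that
      by (simp add: suminf_ennreal2 sums_iff less_imp_le del: power_Suc)
  qed
  have meas: "(\<lambda>v. ennreal (weighted_size scaled_weight v) * indicator {s..t} v) \<in> borel_measurable borel"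
  proof -
    have "(\<lambda>v. \<Sum>k. ennreal (scaled_weight ^ Suc k) * (ennreal (m (Suc k) v) * indicator {s..t} v)) \<in> borel_measurable borel"
      using s by (intro borel_measurable_suminf_order borel_measurable_times_ennreal[OF borel_measurable_const mean_size_measurable]) auto
    also have "(\<lambda>v. \<Sum>k. ennreal (scaled_weight ^ Suc k) * (ennreal (m (Suc k) v) * indicator {s..t} v))
        = (\<lambda>v. ennreal (weighted_size scaled_weight v) * indicator {s..t} v)"
    proof
      fix v
      show "(\<Sum>k. ennreal (scaled_weight ^ Suc k) * (ennreal (m (Suc k) v) * indicator {s..t} v))
          = ennreal (weighted_size scaled_weight v) * indicator {s..t} v"
      proof (cases "v \<in> {s..t}")
        case True
        then have "0 \<le> v" using s by simp
        then show ?thesis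
          using mean_size_pos[of "Suc _" v]
          by (intro ennreal_series_mult weighted_size_sums(1) scaled_weight) (auto intro: less_imp_le)
      qed simp
    qed
    finally show ?thesis .
  qed
  let ?l = "\<lambda>k. \<gamma> * \<zeta> powi (- int (Suc k))"
  have bal: "ennreal (a ^ Suc k) * ennreal (m (Suc k) t)
      + ennreal (a ^ Suc k) * (\<integral>\<^sup>+v. ennreal (?l k * m (Suc k) v) * indicator {s..t} v \<partial>lborel)
    = ennreal (a ^ Suc k) * ennreal (m (Suc k) s)
      + ennreal (a ^ Suc k) * (\<integral>\<^sup>+v. ennreal (?l k * \<phi> (Suc k) v) * indicator {s..t} v \<partial>lborel)" for k
    unfolding distrib_left[symmetric] using mean_size_balance[of s t "Suc k"] s by simp
  have "ennreal (weighted_size a t) + ennreal \<gamma> * ?J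
      = ennreal (weighted_size a s) + ennreal \<gamma> * (\<integral>\<^sup>+v. ennreal (total_gain * weighted_size scaled_weight v) * indicator {s..t} v \<partial>lborel)"
  proof -
    have 1: "(\<Sum>k. ennreal (a ^ Suc k) * (\<integral>\<^sup>+v. ennreal (?l k * m (Suc k) v) * indicator {s..t} v \<partial>lborel)) = ennreal \<gamma> * ?J"
      using s scaled_weight mean_size_pos[of "Suc _"] by (intro suminf_weighted_integral mean_size_measurable weighted_size_sums(1)) (auto intro: less_imp_le)
    have 2: "(\<Sum>k. ennreal (a ^ Suc k) * (\<integral>\<^sup>+v. ennreal (?l k * \<phi> (Suc k) v) * indicator {s..t} v \<partial>lborel))
        = ennreal \<gamma> * (\<integral>\<^sup>+v. ennreal (total_gain * weighted_size scaled_weight v) * indicator {s..t} v \<partial>lborel)"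
      using s offspring_size_nonneg by (intro suminf_weighted_integral offspring_size_measurable weighted_offspring_sums) auto
    show ?thesis
      unfolding 1[symmetric] 2[symmetric]
      using sum_a[of t, symmetric] sum_a[of s, symmetric] s bal
      by (simp only: suminf_add[OF summableI summableI] order.strict_implies_order order_trans[OF s(1)])
  qed
  also have "(\<integral>\<^sup>+v. ennreal (total_gain * weighted_size scaled_weight v) * indicator {s..t} v \<partial>lborel) = ennreal total_gain * ?J"
  proof -
    have "(\<integral>\<^sup>+v. ennreal (total_gain * weighted_size scaled_weight v) * indicator {s..t} v \<partial>lborel)
        = (\<integral>\<^sup>+v. ennreal total_gain * (ennreal (weighted_size scaled_weight v) * indicator {s..t} v) \<partial>lborel)"
      using s total_gain(2) weighted_size_sums(3)[OF _ scaled_weight]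
      by (intro nn_integral_cong) (auto simp: indicator_def ennreal_mult less_imp_le)
    also have "\<dots> = ennreal total_gain * ?J"
      using meas by (intro nn_integral_cmult) simp
    finally show ?thesis .
  qed
  finally have eq: "ennreal (weighted_size a t) + ennreal \<gamma> * ?J
      = ennreal (weighted_size a s) + ennreal \<gamma> * (ennreal total_gain * ?J)" .
  \<comment> \<open>The Gronwall bound is increasing in time, so its value at \<open>t\<close> bounds the integrand on \<open>[s, t]\<close>.\<close>
  have "?J < \<infinity>"
  proof -
    have "?J \<le> (\<integral>\<^sup>+v. ennreal (a / (1 - a) * exp (\<gamma> * total_gain * t)) * indicator {s..t} v \<partial>lborel)"
    proof (intro nn_integral_mono)
      fix v
      have "weighted_size scaled_weight v \<le> a / (1 - a) * exp (\<gamma> * total_gain * t)" if "v \<in> {s..t}"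
      proof (rule order_trans[OF weighted_size_sums(2)[OF _ scaled_weight]])
        show "a / (1 - a) * exp (\<gamma> * total_gain * v) \<le> a / (1 - a) * exp (\<gamma> * total_gain * t)"
          using that weight rate total_gain(2) by (intro mult_left_mono) (auto intro: mult_left_mono)
      qed (use that s in auto)
      then show "ennreal (weighted_size scaled_weight v) * indicator {s..t} v
          \<le> ennreal (a / (1 - a) * exp (\<gamma> * total_gain * t)) * indicator {s..t} v"
        by (auto simp: indicator_def intro: ennreal_leI)
    qed
    also have "\<dots> < \<infinity>"
      using s by (simp add: nn_integral_cmult_indicator ennreal_mult_less_top)
    finally show ?thesis .
  qed
  then obtain J where J: "?J = ennreal J" "0 \<le> J"
    by (cases ?J) auto
  have "J \<noteq> 0"
  proof
    assume "J = 0"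
    then have "emeasure lborel {v \<in> space lborel. ennreal (weighted_size scaled_weight v) * indicator {s..t} v \<noteq> 0} = 0"
      using meas J(1) by (intro nn_integral_0_iff[THEN iffD1]) auto
    also have "{v \<in> space lborel. ennreal (weighted_size scaled_weight v) * indicator {s..t} v \<noteq> 0} = {s..t}"
      using weighted_size_sums(3)[OF _ scaled_weight] s by (auto simp: indicator_def ennreal_eq_0_iff not_le)
    finally show False using s by simp
  qed
  show thesis
  proof
    show "0 < J" using J \<open>J \<noteq> 0\<close> by simp
    have pos: "0 \<le> weighted_size a s" "0 \<le> weighted_size a t"
      using weighted_size_sums(3)[OF _ weight(1) order_refl] s by (auto intro: less_imp_le)
    have "ennreal (weighted_size a t + \<gamma> * J) = ennreal (weighted_size a t) + ennreal \<gamma> * ?J"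
      using pos J rate by (simp add: ennreal_mult)
    also have "\<dots> = ennreal (weighted_size a s + \<gamma> * (total_gain * J))"
      unfolding eq using pos J rate total_gain(2) by (simp add: ennreal_mult)
    finally show "weighted_size a t + \<gamma> * J = weighted_size a s + \<gamma> * (total_gain * J)"
      using pos J rate total_gain(2) by (subst (asm) ennreal_inj) auto
  qed
qed

end

section \<open>The sign of the Tokunaga series\<close>

text \<open>Cauchy-Hadamard; at index 0, where \<open>T\<close> may be negative, the root is 0 by convention.\<close>
lemma conv_radius_tokunaga:
  assumes "\<And>k. 1 \<le> k \<Longrightarrow> 0 \<le> T k"
  shows "conv_radius T = 1 / tokunaga_limsup T"
proof -
  have "root n (norm (T n)) = root n (T n)" for n
    using assms[of n] by (cases n) auto
  then show ?thesis
    by (simp add: conv_radius_def tokunaga_limsup_def divide_ereal_def)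
qed

lemma tokunaga_limsup_nonneg:
  assumes "\<And>k. 1 \<le> k \<Longrightarrow> 0 \<le> T k"
  shows "0 \<le> tokunaga_limsup T"
proof -
  have "0 \<le> root n (T n)" for n
    using assms[of n] by (cases n) auto
  then show ?thesis
    unfolding tokunaga_limsup_def by (intro le_Limsup) auto
qed

text \<open>
  \<open>\<zeta>\<close> dominates \<open>L\<close> and \<open>a < 1\<close>, so \<open>a L < \<zeta>\<close>. The case \<open>L = 0\<close> is separate because there the radius is
  infinite.
\<close>
lemma scaled_weight_in_radius:
  assumes T: "\<And>k. 1 \<le> k \<Longrightarrow> 0 \<le> T k"
    and a: "0 < a" "a < 1" and \<zeta>: "max 1 (tokunaga_limsup T) \<le> ereal \<zeta>"
  shows "ereal \<bar>a / \<zeta>\<bar> < 1 / tokunaga_limsup T"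
proof -
  have \<zeta>1: "1 \<le> \<zeta>" using \<zeta> by simp
  obtain l where l: "tokunaga_limsup T = ereal l" "0 \<le> l" "l \<le> \<zeta>"
    using \<zeta> tokunaga_limsup_nonneg[of T, OF T] by (cases "tokunaga_limsup T") auto
  show ?thesis
  proof (cases "l = 0")
    case True then show ?thesis using l by (simp add: zero_ereal_def[symmetric] divide_ereal_def)
  next
    case False
    have "a * l < \<zeta>"
      using a False l by (smt (verit) mult_less_cancel_right2)
    then have "a / \<zeta> < 1 / l"
      using False l \<zeta>1 by (simp add: field_simps)
    then show ?thesis using l False a \<zeta>1 by (simp add: one_ereal_def)
  qed
qed

lemma t_hat_series:
  assumes T: "\<And>k. 1 \<le> k \<Longrightarrow> 0 \<le> T k" and z: "ereal \<bar>z\<bar> < 1 / tokunaga_limsup T"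
  shows "summable (\<lambda>k. z ^ Suc k * T (Suc k))"
    and "(\<lambda>k. gain T (Suc k) * z ^ Suc k) sums (1 + t_hat T z)"
proof -
  have "summable (\<lambda>k. T k * z ^ k)"
    using z conv_radius_tokunaga[of T, OF T] by (intro summable_in_conv_radius) simp
  then show *: "summable (\<lambda>k. z ^ Suc k * T (Suc k))"
    by (subst (asm) summable_Suc_iff[symmetric]) (simp add: mult.commute)
  have "(\<lambda>k. if k = 0 then 2 * z else 0) sums (2 * z)"
    using sums_single[of 0 "\<lambda>_. 2 * z"] by simp
  from sums_add[OF this summable_sums[OF *]]
  have "(\<lambda>k. (if k = 0 then 2 * z else 0) + z ^ Suc k * T (Suc k)) sums (1 + t_hat T z)"
    by (simp add: t_hat_def)
  moreover have "(if k = 0 then 2 * z else 0) + z ^ Suc k * T (Suc k) = gain T (Suc k) * z ^ Suc k" for k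
    by (simp add: gain_def algebra_simps)
  ultimately show "(\<lambda>k. gain T (Suc k) * z ^ Suc k) sums (1 + t_hat T z)" by simp
qed

text \<open>The term \<open>2 z\<close> increases strictly and the coefficients of the series are nonnegative.\<close>
lemma t_hat_strict_mono:
  assumes T: "\<And>k. 1 \<le> k \<Longrightarrow> 0 \<le> T k" and z: "0 < z" "z < w" "ereal \<bar>w\<bar> < 1 / tokunaga_limsup T"
  shows "t_hat T z < t_hat T w"
proof -
  have "ereal \<bar>z\<bar> < ereal \<bar>w\<bar>" using z by simp
  then have "ereal \<bar>z\<bar> < 1 / tokunaga_limsup T" using z(3) by (rule less_trans)
  then have "(\<Sum>k. z ^ Suc k * T (Suc k)) \<le> (\<Sum>k. w ^ Suc k * T (Suc k))"
    using z T by (intro suminf_le t_hat_series(1)[of T] mult_right_mono power_mono) auto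
  then show ?thesis using z by (simp add: t_hat_def)
qed

lemma t_hat_sign:
  assumes T: "\<And>k. 1 \<le> k \<Longrightarrow> 0 \<le> T k" and w: "is_horton_root T w"
    and z: "0 < z" "ereal \<bar>z\<bar> < 1 / tokunaga_limsup T"
  shows "t_hat T z < 0 \<longleftrightarrow> z < w" "t_hat T z = 0 \<longleftrightarrow> z = w" "0 < t_hat T z \<longleftrightarrow> w < z"
  using t_hat_strict_mono[of T z w, OF T] t_hat_strict_mono[of T w z, OF T] w z
  by (cases z w rule: linorder_cases; simp add: is_horton_root_def)+

text \<open>Strict monotonicity makes the root unique, so the definite description denotes it.\<close>
lemma horton_exponent_eq:
  assumes T: "\<And>k. 1 \<le> k \<Longrightarrow> 0 \<le> T k" and w: "is_horton_root T w"
  shows "horton_exponent T = inverse w"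
proof -
  have "(THE w. is_horton_root T w) = w"
    using w t_hat_sign(2)[of T w, OF T w] by (intro the_equality) (auto simp: is_horton_root_def)
  then show ?thesis by (simp add: horton_exponent_def)
qed

theorem theorem6:
  fixes p \<gamma> \<zeta> :: real
    and T :: "nat \<Rightarrow> real"
    and M :: "'w measure"
    and K :: "'w \<Rightarrow> nat"
    and X :: "clock \<Rightarrow> 'w \<Rightarrow> real"
  defines "C \<equiv> width_function M T K X"
    and "L \<equiv> tokunaga_limsup T"
    and "R \<equiv> horton_exponent T"
  assumes process: "self_similar_hbp p \<gamma> \<zeta> T M K X"
    and p: "0 < p" "p < 1"
    and \<gamma>: "\<gamma> > 0"
    and L_finite: "L < \<infinity>"
    and \<zeta>: "ereal \<zeta> \<ge> max 1 L"
    and root_exists: "\<exists>w. is_horton_root T w"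
  shows "(p > 1 - \<zeta> / R \<longrightarrow> strict_antimono_on {0..} C)
       \<and> (p = 1 - \<zeta> / R \<longrightarrow> (\<forall>s\<ge>0. C s = 1))
       \<and> (p < 1 - \<zeta> / R \<longrightarrow> strict_mono_on {0..} C)"
proof -
  obtain w where w: "is_horton_root T w" using root_exists by blast
  interpret hierarchical_branching_process M T "\<lambda>j. \<gamma> * \<zeta> powi (- int j)" "\<lambda>k. p * (1 - p) ^ (k - 1)" K X
    using process by (simp add: self_similar_hbp_def)
  have T: "0 \<le> T k" if "1 \<le> k" for k using T_nonneg that by simp
  define a where "a = 1 - p"
  have a: "0 < a" "a < 1" using p by (auto simp: a_def)
  have \<zeta>1: "1 \<le> \<zeta>" using \<zeta> by simp
  have radius: "ereal \<bar>a / \<zeta>\<bar> < 1 / tokunaga_limsup T"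
    by (rule scaled_weight_in_radius[of T, OF T a \<zeta>[unfolded L_def]])
  note series = t_hat_series(2)[of T, OF T radius]
  interpret S: self_similar_rates T \<gamma> \<zeta> a
    using T \<gamma> \<zeta>1 a sums_summable[OF series] by unfold_locales auto
  let ?F = "S.weighted_size a"
  have gain: "S.total_gain = 1 + t_hat T (a / \<zeta>)"
    using sums_unique[OF series] by (simp add: S.total_gain_def S.scaled_weight_def)
  have C: "C s = ennreal (p / a * ?F s)" if s: "0 \<le> s" for s
  proof -
    note F = S.weighted_size_sums(1)[OF s a(1) order_refl]
    have "p * (1 - p) ^ (Suc k - 1) * rates.m (Suc k) s = p / a * (a ^ Suc k * rates.m (Suc k) s)" for k
      using a by (simp add: a_def)
    then have "C s = (\<Sum>k. ennreal (p / a * (a ^ Suc k * rates.m (Suc k) s)))"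
      unfolding C_def width_function_eq[OF s] by simp
    also have "\<dots> = ennreal (p / a * ?F s)"
      using sums_mult[OF F, of "p / a"] a p rates.mean_size_pos[of "Suc _" s] s
      by (subst suminf_ennreal2) (auto simp: sums_iff less_imp_le simp del: power_Suc)
    finally show ?thesis .
  qed
  have pos: "0 < ?F s" if "0 \<le> s" for s
    using S.weighted_size_sums(3)[OF that a(1) order_refl] .
  have C_less: "C s < C t \<longleftrightarrow> ?F s < ?F t" and C_eq: "C s = C t \<longleftrightarrow> ?F s = ?F t" if "0 \<le> s" "0 \<le> t" for s t
    using that pos[OF that(1)] pos[OF that(2)] a p
    by (auto simp: C ennreal_less_iff mult_less_cancel_left_pos divide_less_cancel)
  have trend: "\<exists>J>0. ?F t - ?F s = \<gamma> * J * t_hat T (a / \<zeta>)" if st: "0 \<le> s" "s < t" for s t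
  proof -
    obtain J where "0 < J" "?F t + \<gamma> * J = ?F s + \<gamma> * (S.total_gain * J)"
      by (rule S.weighted_size_balance[OF st])
    then show ?thesis by (intro exI[of _ J]) (simp add: gain algebra_simps)
  qed
  have ratio: "\<zeta> / R = \<zeta> * w"
    using horton_exponent_eq[of T, OF T w] by (simp add: R_def divide_inverse)
  have "0 < a / \<zeta>" using a \<zeta>1 by simp
  then have sign: "t_hat T (a / \<zeta>) < 0 \<longleftrightarrow> a / \<zeta> < w" "t_hat T (a / \<zeta>) = 0 \<longleftrightarrow> a / \<zeta> = w"
    "0 < t_hat T (a / \<zeta>) \<longleftrightarrow> w < a / \<zeta>"
    using T radius w by (intro t_hat_sign; simp)+
  show ?thesis
  proof (intro conjI impI)
    assume "1 - \<zeta> / R < p"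
    then have neg: "t_hat T (a / \<zeta>) < 0"
      unfolding sign ratio using \<zeta>1 by (simp add: a_def field_simps)
    show "strict_antimono_on {0..} C"
    proof (rule monotone_onI)
      fix s t :: real assume "s \<in> {0..}" "t \<in> {0..}" and st: "s < t"
      then have s: "0 \<le> s" "0 \<le> t" by auto
      obtain J where "0 < J" "?F t - ?F s = \<gamma> * J * t_hat T (a / \<zeta>)" using trend[OF s(1) st] by blast
      then have "?F t - ?F s < 0" using neg \<gamma> by (simp add: mult_pos_neg)
      then show "C s > C t" using s by (simp add: C_less)
    qed
  next
    assume "p = 1 - \<zeta> / R"
    then have zero: "t_hat T (a / \<zeta>) = 0"
      unfolding sign ratio using \<zeta>1 by (simp add: a_def field_simps)
  \<comment> \<open>The value at time 0 is the total mass of the root law.\<close>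
  have "(\<Sum>k. a ^ Suc k) = a / (1 - a)"
      using sums_mult[OF geometric_sums[of a], of a] a by (simp add: sums_iff)
    then have C0: "C 0 = 1"
      using a p by (simp add: C S.weighted_size_def) (simp add: a_def)
    show "\<forall>s\<ge>0. C s = 1"
    proof (intro allI impI)
      fix s :: real assume s: "0 \<le> s"
      have "?F s = ?F 0"
        using trend[of 0 s] zero s by (cases "s = 0") auto
      then show "C s = 1" using C0 C_eq[OF s order_refl] by simp
    qed
  next
    assume "p < 1 - \<zeta> / R"
    then have pos: "0 < t_hat T (a / \<zeta>)"
      unfolding sign ratio using \<zeta>1 by (simp add: a_def field_simps)
    show "strict_mono_on {0..} C"
    proof (rule monotone_onI)
      fix s t :: real assume "s \<in> {0..}" "t \<in> {0..}" and st: "s < t"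
      then have s: "0 \<le> s" "0 \<le> t" by auto
      obtain J where "0 < J" "?F t - ?F s = \<gamma> * J * t_hat T (a / \<zeta>)" using trend[OF s(1) st] by blast
      then have "0 < ?F t - ?F s" using pos \<gamma> by simp
      then show "C s < C t" using s by (simp add: C_less)
    qed
  qed
qed

end
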